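(* Let $T>0$. For every $\mu\in\mathcal{M}^{+}((0,T])$ and $\rho_0\in\mathcal{M}^{+}([0,1))$ with zero singular continuous parts, the unique Lagrangian solution (and thus also the unique measure-valued weak solution) $\rho\colon[0,T]\to\mathcal{M}^{+}([0,1))$ with initial datum $\rho_0$ and influx $\mu$ is continuous under the seminorm $\phi$; that is, for every $t_0\in[0,T]$, $\phi(\rho_t-\rho_{t_0})\to0$ as $t\to t_0$, $t\in[0,T]$.
   Context: For an interval $I\subseteq\mathbb{R}$, $\mathcal{M}(I)$ and $\mathcal{M}^{+}(I)$ denote the signed, respectively nonnegative, finite Borel measures on $I$. The velocity $\alpha\colon[0,\infty)\to(0,1]$ is a fixed strictly decreasing, Lipschitz continuous function with $\alpha(0)=1$. Seminorm $\phi$: let $\mathcal{F}$ be the set of functions $f\colon[0,1)\to[0,1]$ with $|f(x)-f(y)|\le|x-y|$ for all $x,y\in[0,1)$; let $h(x)=\frac12-\left|\frac12-x\right|$ for $x\in[0,1)$ and $h(x)=0$ otherwise. For $\nu\in\mathcal{M}([0,1))$ put $\phi(\nu)=\sup_{f\in\mathcal{F}}\left|\int_{[0,1)}f h\,d\nu\right|$. Semiflow: for $v\colon[0,T]\times[0,\infty)\to(0,1]$ integrable in the first variable and constant in the second variable, the semiflow of $v$ is the map $X\colon\{(t,r)\colon 0\le r\le t\le T\}\times[0,\infty)\to[0,\infty)$ such that for all $r\in[0,T]$ and $x_0\in[0,\infty)$: $X(r;r,x_0)=x_0$, $t\mapsto X(t;r,x_0)$ is absolutely continuous on $[r,T]$,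 and $\frac{\partial}{\partial t}X(t;r,x_0)=v(t,X(t;r,x_0))$ for almost every $t\in[r,T]$. Lagrangian solution: a function $\rho\colon[0,T]\to\mathcal{M}^{+}([0,1))$ is a Lagrangian solution with initial datum $\rho_0$ and influx $\mu$ if for every $t\in[0,T]$ and every Borel set $E\subseteq[0,1)$ $$\rho_t(E)=\int_{[0,1)}\chi_E(X(t;0,x_0))\,d\rho_0(x_0)+\int_{(0,t]}\chi_E(X(t;s,0))\,d\mu(s),$$ where $\chi_E$ is the indicator function of $E$ and $X$ is the semiflow of the vector field $v(t,x)=\alpha(W(t))$, $W(t)=\rho_t([0,1))$ (with $W$ measurable). The paper establishes that the Lagrangian solution exists, is unique, and coincides with the unique weak solution. Weak solution: a function $\rho\colon[0,T]\to\mathcal{M}^{+}([0,1))$ such that $W\colon t\mapsto\rho_t([0,1))$ is integrable and, for every $\tau\in[0,T]$ and $\varphi\in\Psi$, $$0=\int_{(0,\tau]}\int_{[0,1)}\bigl(\partial_t\varphi+\alpha(W(t))\,\partial_x\varphi\bigr)(t,x)\,d\rho_t(x)\,dt+\int_{(0,\tau]}\varphi(t,0)\,d\mu(t)-\int_{[0,1)}\varphi(\tau,x)\,d\rho_\tau(x)+\int_{[0,1)}\varphi(0,x)\,d\rho_0(x),$$ where $\Psi$ is the set of $\varphi\colon[0,T]\times[0,1]\to\mathbb{R}$ such that for every $t$, $\varphi(t,1)=0$ and $\varphi(t,\cdot)$ is differentiable, $\partial_x\varphi$ is jointly continuous, and for every $x\in[0,1)$, $\varphi(\cdot,x)$ is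 Lipschitz continuous. *)

theory Defs
  imports "HOL-Analysis.Analysis"
begin

definition finite_borel_measure_on :: "real set \<Rightarrow> real measure \<Rightarrow> bool" where
  "finite_borel_measure_on I M \<longleftrightarrow>
     finite_measure M \<and> sets M = sets (restrict_space borel I)"

definition lebesgue_decomposition ::
    "real set \<Rightarrow> real measure \<Rightarrow> real measure \<Rightarrow> real measure \<Rightarrow> real measure \<Rightarrow> bool" where
  "lebesgue_decomposition I M ac pp sc \<longleftrightarrow>
     finite_borel_measure_on I ac \<and> finite_borel_measure_on I pp \<and> finite_borel_measure_on I sc \<and>
     (\<forall>E\<in>sets (restrict_space borel I). measure M E = measure ac E + measure pp E + measure sc E) \<and>
     absolutely_continuous (restrict_space lborel I) ac \<and>
     (\<exists>C. countable C \<and> C \<subseteq> I \<and> measure pp (I - C) = 0) \<and>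
     (\<forall>x\<in>I. measure sc {x} = 0) \<and>
     (\<exists>N\<in>null_sets (restrict_space lborel I). measure sc (I - N) = 0)"

definition zero_singular_continuous_part :: "real set \<Rightarrow> real measure \<Rightarrow> bool" where
  "zero_singular_continuous_part I M \<longleftrightarrow>
     (\<exists>ac pp. lebesgue_decomposition I M ac pp (null_measure M))"

text \<open>
  A finite signed Borel measure on \<open>I\<close> is given by its set function \<open>\<nu>\<close>.  The integral of a
  bounded Borel function is computed from a decomposition \<open>\<nu> = P - N\<close> into finite nonnegative
  measures.  Such a decomposition exists (Jordan), and the value does not depend on which one is
  chosen: see \<open>signed_integral_eq\<close> below.
\<close>

definition signed_integral :: "real set \<Rightarrow> (real set \<Rightarrow> real) \<Rightarrow> (real \<Rightarrow> real) \<Rightarrow> real" where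
  "signed_integral I \<nu> f =
     (THE r. \<exists>P N. finite_borel_measure_on I P \<and> finite_borel_measure_on I N \<and>
        (\<forall>E\<in>sets (restrict_space borel I). \<nu> E = measure P E - measure N E) \<and>
        r = (LINT x|P. f x) - (LINT x|N. f x))"

definition phi_test_functions :: "(real \<Rightarrow> real) set" where
  "phi_test_functions =
     {f. f \<in> {0..<1} \<rightarrow> {0..1} \<and> (\<forall>x\<in>{0..<1}. \<forall>y\<in>{0..<1}. \<bar>f x - f y\<bar> \<le> \<bar>x - y\<bar>)}"

definition hat :: "real \<Rightarrow> real" where
  "hat x = (if x \<in> {0..<1} then 1/2 - \<bar>1/2 - x\<bar> else 0)"

definition phi :: "(real set \<Rightarrow> real) \<Rightarrow> real" where
  "phi \<nu> = (SUP f\<in>phi_test_functions. \<bar>signed_integral {0..<1} \<nu> (\<lambda>x. f x * hat x)\<bar>)"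

definition measure_diff :: "real measure \<Rightarrow> real measure \<Rightarrow> real set \<Rightarrow> real" where
  "measure_diff M N = (\<lambda>E. measure M E - measure N E)"

definition velocity :: "(real \<Rightarrow> real) \<Rightarrow> bool" where
  "velocity \<alpha> \<longleftrightarrow>
     \<alpha> \<in> {0..} \<rightarrow> {0<..1} \<and> strict_antimono_on {0..} \<alpha> \<and> (\<exists>L. L-lipschitz_on {0..} \<alpha>) \<and> \<alpha> 0 = 1"

definition absolutely_continuous_fun_on :: "real \<Rightarrow> real \<Rightarrow> (real \<Rightarrow> real) \<Rightarrow> bool" where
  "absolutely_continuous_fun_on a b f \<longleftrightarrow>
     (\<forall>\<epsilon>>0. \<exists>\<delta>>0. \<forall>D. finite D \<longrightarrow>
        (\<forall>(u, w)\<in>D. a \<le> u \<and> u \<le> w \<and> w \<le> b) \<longrightarrow>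
        disjoint_family_on (\<lambda>(u, w). {u<..<w}) D \<longrightarrow>
        (\<Sum>(u, w)\<in>D. w - u) < \<delta> \<longrightarrow> (\<Sum>(u, w)\<in>D. \<bar>f w - f u\<bar>) < \<epsilon>)"

text \<open>\<open>X t r x\<close> stands for $X(t;r,x)$; it is constrained only for \<open>0 \<le> r \<le> t \<le> T\<close> and \<open>0 \<le> x\<close>.\<close>

definition semiflow ::
    "real \<Rightarrow> (real \<Rightarrow> real \<Rightarrow> real) \<Rightarrow> (real \<Rightarrow> real \<Rightarrow> real \<Rightarrow> real) \<Rightarrow> bool" where
  "semiflow T v X \<longleftrightarrow>
     (\<forall>r\<in>{0..T}. \<forall>x\<ge>0.
        (\<forall>t\<in>{r..T}. 0 \<le> X t r x) \<and>
        X r r x = x \<and>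
        absolutely_continuous_fun_on r T (\<lambda>t. X t r x) \<and>
        (AE t in lebesgue_on {r..T}.
           ((\<lambda>s. X s r x) has_real_derivative v t (X t r x)) (at t within {r..T})))"

definition mass :: "(real \<Rightarrow> real measure) \<Rightarrow> real \<Rightarrow> real" where
  "mass \<rho> t = measure (\<rho> t) {0..<1}"

definition lagrangian_solution ::
    "real \<Rightarrow> (real \<Rightarrow> real) \<Rightarrow> real measure \<Rightarrow> real measure \<Rightarrow> (real \<Rightarrow> real measure) \<Rightarrow> bool" where
  "lagrangian_solution T \<alpha> \<rho>0 \<mu> \<rho> \<longleftrightarrow>
     (\<forall>t\<in>{0..T}. finite_borel_measure_on {0..<1} (\<rho> t)) \<and>
     mass \<rho> \<in> borel_measurable (lebesgue_on {0..T}) \<and>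
     (\<exists>X. semiflow T (\<lambda>t x. \<alpha> (mass \<rho> t)) X \<and>
        (\<forall>t\<in>{0..T}. \<forall>E\<in>sets (restrict_space borel {0..<1}).
           measure (\<rho> t) E =
             (LINT x|\<rho>0. indicator E (X t 0 x)) + (LINT s:{0<..t}|\<mu>. indicator E (X t s 0))))"

definition dt :: "real \<Rightarrow> (real \<Rightarrow> real \<Rightarrow> real) \<Rightarrow> real \<Rightarrow> real \<Rightarrow> real" where
  "dt T \<phi> t x = vector_derivative (\<lambda>s. \<phi> s x) (at t within {0..T})"

definition dx :: "(real \<Rightarrow> real \<Rightarrow> real) \<Rightarrow> real \<Rightarrow> real \<Rightarrow> real" where
  "dx \<phi> t x = vector_derivative (\<lambda>y. \<phi> t y) (at x within {0..1})"

definition weak_test_functions :: "real \<Rightarrow> (real \<Rightarrow> real \<Rightarrow> real) set" where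
  "weak_test_functions T =
     {\<phi>. (\<forall>t\<in>{0..T}. \<phi> t 1 = 0 \<and> \<phi> t differentiable_on {0..1}) \<and>
         continuous_on ({0..T} \<times> {0..1}) (\<lambda>(t, x). dx \<phi> t x) \<and>
         (\<forall>x\<in>{0..<1}. \<exists>L. L-lipschitz_on {0..T} (\<lambda>t. \<phi> t x))}"

definition transport_term ::
    "real \<Rightarrow> (real \<Rightarrow> real) \<Rightarrow> (real \<Rightarrow> real measure) \<Rightarrow> (real \<Rightarrow> real \<Rightarrow> real) \<Rightarrow> real \<Rightarrow> real \<Rightarrow> real" where
  "transport_term T \<alpha> \<rho> \<phi> t x = dt T \<phi> t x + \<alpha> (mass \<rho> t) * dx \<phi> t x"

text \<open>
  A function \<open>\<phi>(\<cdot>,x)\<close> is differentiable only almost everywhere and its Lipschitz constant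
  may depend on \<open>x\<close>, so the space-time integral in the weak formulation need not make sense for
  every test function.  Since the Bochner integral of a nonintegrable function is \<open>0\<close>, the cases in
  which it does make sense have to be singled out explicitly.
\<close>

definition transport_integral_exists ::
    "real \<Rightarrow> (real \<Rightarrow> real) \<Rightarrow> (real \<Rightarrow> real measure) \<Rightarrow> (real \<Rightarrow> real \<Rightarrow> real) \<Rightarrow> real \<Rightarrow> bool" where
  "transport_integral_exists T \<alpha> \<rho> \<phi> \<tau> \<longleftrightarrow>
     (AE t in lebesgue_on {0<..\<tau>}.
        (AE x in \<rho> t. (\<lambda>s. \<phi> s x) differentiable (at t within {0..T})) \<and>
        integrable (\<rho> t) (transport_term T \<alpha> \<rho> \<phi> t)) \<and>
     integrable (lebesgue_on {0<..\<tau>}) (\<lambda>t. LINT x|\<rho> t. \<bar>transport_term T \<alpha> \<rho> \<phi> t x\<bar>) \<and>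
     integrable (lebesgue_on {0<..\<tau>}) (\<lambda>t. LINT x|\<rho> t. transport_term T \<alpha> \<rho> \<phi> t x)"

definition weak_solution ::
    "real \<Rightarrow> (real \<Rightarrow> real) \<Rightarrow> real measure \<Rightarrow> real measure \<Rightarrow> (real \<Rightarrow> real measure) \<Rightarrow> bool" where
  "weak_solution T \<alpha> \<rho>0 \<mu> \<rho> \<longleftrightarrow>
     (\<forall>t\<in>{0..T}. finite_borel_measure_on {0..<1} (\<rho> t)) \<and>
     integrable (lebesgue_on {0..T}) (mass \<rho>) \<and>
     (\<forall>\<tau>\<in>{0..T}. \<forall>\<phi>\<in>weak_test_functions T.
        transport_integral_exists T \<alpha> \<rho> \<phi> \<tau> \<longrightarrow>
        0 = (LINT t|lebesgue_on {0<..\<tau>}. LINT x|\<rho> t. transport_term T \<alpha> \<rho> \<phi> t x)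
          + (LINT t:{0<..\<tau>}|\<mu>. \<phi> t 0)
          - (LINT x|\<rho> \<tau>. \<phi> \<tau> x)
          + (LINT x|\<rho>0. \<phi> 0 x))"

definition phi_continuous :: "real \<Rightarrow> (real \<Rightarrow> real measure) \<Rightarrow> bool" where
  "phi_continuous T \<rho> \<longleftrightarrow>
     (\<forall>t0\<in>{0..T}. ((\<lambda>t. phi (measure_diff (\<rho> t) (\<rho> t0))) \<longlongrightarrow> 0) (at t0 within {0..T}))"

lemma finite_borel_measure_onD:
  assumes "finite_borel_measure_on I M"
  shows "finite_measure M" "sets M = sets (restrict_space borel I)" "space M = I"
  using assms sets_eq_imp_space_eq[of M "restrict_space borel I"]
  by (auto simp: finite_borel_measure_on_def space_restrict_space)

lemma nn_integral_add_measure_cong: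
  fixes f :: "real \<Rightarrow> ennreal"
  assumes s: "sets B = sets A" "sets C = sets A" "sets D = sets A"
    and eq: "\<And>E. E \<in> sets A \<Longrightarrow> emeasure A E + emeasure B E = emeasure C E + emeasure D E"
    and f: "f \<in> borel_measurable A"
  shows "nn_integral A f + nn_integral B f = nn_integral C f + nn_integral D f"
  using f
proof (induction rule: borel_measurable_induct)
  case (cong f g)
  have "space B = space A" "space C = space A" "space D = space A"
    using s[THEN sets_eq_imp_space_eq] by simp_all
  then have "nn_integral M f = nn_integral M g" if "M \<in> {A, B, C, D}" for M
    using cong(3) that by (intro nn_integral_cong) auto
  then show ?case using cong(4) by simp
next
  case (set E)
  then show ?case using eq s by simp
next
  case (mult u c)
  have "u \<in> borel_measurable B" "u \<in> borel_measurable C" "u \<in> borel_measurable D"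
    using mult(2) s by (simp_all cong: measurable_cong_sets)
  then show ?case using mult by (simp add: nn_integral_cmult flip: distrib_left)
next
  case (add u v)
  have "u \<in> borel_measurable B" "u \<in> borel_measurable C" "u \<in> borel_measurable D"
    "v \<in> borel_measurable B" "v \<in> borel_measurable C" "v \<in> borel_measurable D"
    using add s by (simp_all cong: measurable_cong_sets)
  then show ?case using add by (simp add: nn_integral_add) (metis add.assoc add.left_commute)
next
  case (seq U)
  have m: "U i \<in> borel_measurable M" if "M \<in> {A, B, C, D}" for i M
    using seq(1) s that by (auto cong: measurable_cong_sets)
  have eqs: "nn_integral M (\<lambda>x. SUP i. U i x) = (SUP i. nn_integral M (U i))" if "M \<in> {A, B, C, D}" for M
    using m that seq by (intro nn_integral_monotone_convergence_SUP) auto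
  have inc: "incseq (\<lambda>i. nn_integral M (U i))" for M
    using seq by (auto simp: incseq_def le_fun_def intro!: nn_integral_mono)
  have "nn_integral A (\<lambda>x. SUP i. U i x) + nn_integral B (\<lambda>x. SUP i. U i x)
      = (SUP i. nn_integral A (U i) + nn_integral B (U i))"
    by (simp add: eqs ennreal_SUP_add[OF inc inc])
  also have "\<dots> = (SUP i. nn_integral C (U i) + nn_integral D (U i))"
    using seq by simp
  also have "\<dots> = nn_integral C (\<lambda>x. SUP i. U i x) + nn_integral D (\<lambda>x. SUP i. U i x)"
    by (simp add: eqs ennreal_SUP_add[OF inc inc])
  finally show ?case by (simp add: image_comp SUP_apply[abs_def] del: SUP_apply)
qed

lemma signed_integral_eq:
  assumes P: "finite_borel_measure_on I P" and N: "finite_borel_measure_on I N"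
    and f: "f \<in> borel_measurable (restrict_space borel I)"
    and bd: "\<And>x. x \<in> I \<Longrightarrow> \<bar>f x\<bar> \<le> B"
    and \<nu>: "\<And>E. E \<in> sets (restrict_space borel I) \<Longrightarrow> \<nu> E = measure P E - measure N E"
  shows "signed_integral I \<nu> f = (LINT x|P. f x) - (LINT x|N. f x)"
proof -
  have mf: "f \<in> borel_measurable M" if "finite_borel_measure_on I M" for M
    using f finite_borel_measure_onD(2)[OF that] by (simp cong: measurable_cong_sets)
  have int: "integrable M f" if M: "finite_borel_measure_on I M" for M
  proof -
    interpret finite_measure M using finite_borel_measure_onD[OF M] by simp
    show ?thesis
      using mf[OF M] bd finite_borel_measure_onD(3)[OF M]
      by (intro integrable_const_bound[where B = B]) auto
  qed
  have key: "(LINT x|P. f x) - (LINT x|N. f x) = (LINT x|P'. f x) - (LINT x|N'. f x)"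
    if P': "finite_borel_measure_on I P'" and N': "finite_borel_measure_on I N'"
      and e: "\<And>E. E \<in> sets (restrict_space borel I) \<Longrightarrow>
        measure P E - measure N E = measure P' E - measure N' E" for P' N'
  proof -
    have fin: "emeasure M E = ennreal (measure M E)" if "M \<in> {P, N, P', N'}" for M E
      using that P N P' N' finite_borel_measure_onD(1) finite_measure.emeasure_eq_measure by blast
    have em: "emeasure P E + emeasure N' E = emeasure P' E + emeasure N E" if "E \<in> sets P" for E
    proof -
      have "measure P E + measure N' E = measure P' E + measure N E"
        using e[of E] that finite_borel_measure_onD(2)[OF P] by simp
      then show ?thesis by (simp add: fin flip: ennreal_plus)
    qed
    have nn: "nn_integral P g + nn_integral N' g = nn_integral P' g + nn_integral N g"
      if "g \<in> borel_measurable P" for g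
      using that em finite_borel_measure_onD(2)[OF P] finite_borel_measure_onD(2)[OF N]
        finite_borel_measure_onD(2)[OF P'] finite_borel_measure_onD(2)[OF N']
      by (intro nn_integral_add_measure_cong) auto
    have nng: "(LINT x|P. g x) + (LINT x|N'. g x) = (LINT x|P'. g x) + (LINT x|N. g x)"
      if g: "\<And>x. 0 \<le> g x" "\<And>M. finite_borel_measure_on I M \<Longrightarrow> integrable M g" for g :: "real \<Rightarrow> real"
    proof -
      have "nn_integral M (\<lambda>x. ennreal (g x)) = ennreal (LINT x|M. g x)"
        if "finite_borel_measure_on I M" for M
        using g that by (intro nn_integral_eq_integral) auto
      moreover have "(LINT x|M. g x) \<ge> 0" for M
        using g by (intro integral_nonneg_AE) auto
      ultimately show ?thesis
        using nn[of "\<lambda>x. ennreal (g x)"] P N P' N' g(2)[OF P]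
        by (simp add: ennreal_inj borel_measurable_integrable flip: ennreal_plus)
    qed
    have pos: "integrable M (\<lambda>x. max 0 (f x))" and neg: "integrable M (\<lambda>x. max 0 (- f x))"
      if "finite_borel_measure_on I M" for M
      using int[OF that] by (auto intro!: integrable_max)
    have "f x = max 0 (f x) - max 0 (- f x)" for x
      by simp
    then have "(LINT x|M. f x) = (LINT x|M. max 0 (f x)) - (LINT x|M. max 0 (- f x))"
      if M: "finite_borel_measure_on I M" for M
      using Bochner_Integration.integral_diff[OF pos[OF M] neg[OF M]] by presburger
    then show ?thesis
      using pos neg nng[of "\<lambda>x. max 0 (f x)"] nng[of "\<lambda>x. max 0 (- f x)"] P N P' N' by simp
  qed
  show ?thesis
    unfolding signed_integral_def
  proof (rule the_equality)
    show "\<exists>P' N'. finite_borel_measure_on I P' \<and> finite_borel_measure_on I N' \<and>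
        (\<forall>E\<in>sets (restrict_space borel I). \<nu> E = measure P' E - measure N' E) \<and>
        (LINT x|P. f x) - (LINT x|N. f x) = (LINT x|P'. f x) - (LINT x|N'. f x)"
      using P N \<nu> by blast
  next
    fix r
    assume "\<exists>P' N'. finite_borel_measure_on I P' \<and> finite_borel_measure_on I N' \<and>
        (\<forall>E\<in>sets (restrict_space borel I). \<nu> E = measure P' E - measure N' E) \<and>
        r = (LINT x|P'. f x) - (LINT x|N'. f x)"
    then show "r = (LINT x|P. f x) - (LINT x|N. f x)"
      using key \<nu> by metis
  qed
qed

end

theory Submission
  imports Defs
begin

text \<open>
  All particles present at time \<open>t\<close> move with the same speed \<open>\<alpha> (W t)\<close>, so with the displacement
  \<open>A t = \<integral>\<^sub>0\<^sup>t \<alpha> (W s) ds\<close>, which is nondecreasing and 1-Lipschitz, a solution satisfies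
  \<open>\<integral> g d\<rho>\<^sub>t = \<integral> g (x + A t) d\<rho>\<^sub>0(x) + \<integral>\<^bsub>(0,t]\<^esub> g (A t - A s) d\<mu>(s)\<close> for every Lipschitz \<open>g\<close> vanishing
  off \<open>(0, 1)\<close>.  Each product \<open>f h\<close> in the definition of \<open>\<phi>\<close> is such a function with Lipschitz
  constant 2, and as \<open>f h\<close> vanishes at the inflow point \<open>0\<close>, newly entering mass contributes
  continuously.  Hence \<open>t \<mapsto> \<rho>\<^sub>t\<close> is even Lipschitz continuous for \<open>\<phi>\<close>.

  For Lagrangian solutions the representation comes from the uniqueness of absolutely continuous
  solutions of \<open>X' = \<alpha> (W t)\<close>.  For weak solutions it comes by duality: transporting a terminal
  datum backwards along the characteristics gives a test function annihilating the transport term.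
\<close>

section \<open>Absolutely continuous functions\<close>

lemma has_real_derivative_imp_local_bound:
  fixes f :: "real \<Rightarrow> real"
  assumes "(f has_real_derivative D) (at t within S)" "\<bar>D\<bar> \<le> B" "e > 0"
  shows "\<exists>r>0. \<forall>y\<in>S. \<bar>y - t\<bar> < r \<longrightarrow> \<bar>f y - f t\<bar> \<le> (B + e) * \<bar>y - t\<bar>"
proof -
  have "(f has_derivative (*) D) (at t within S)"
    using assms(1) by (simp add: has_field_derivative_def)
  then obtain r where r: "r > 0"
    "\<And>y. y \<in> S \<Longrightarrow> \<bar>y - t\<bar> < r \<Longrightarrow> \<bar>f y - f t - D * (y - t)\<bar> \<le> e * \<bar>y - t\<bar>"
    unfolding has_derivative_within_alt using assms(3) by (metis real_norm_def)
  have "\<bar>f y - f t\<bar> \<le> (B + e) * \<bar>y - t\<bar>" if "y \<in> S" "\<bar>y - t\<bar> < r" for y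
  proof -
    have "\<bar>D * (y - t)\<bar> \<le> B * \<bar>y - t\<bar>"
      by (simp add: abs_mult assms(2) mult_right_mono)
    then show ?thesis using r(2)[OF that] by (simp add: distrib_right)
  qed
  then show ?thesis using r(1) by blast
qed

text \<open>An almost-everywhere mean value inequality. Off \<open>N\<close> the derivative bound
  controls the increment of \<open>f\<close> over every short interval containing the tag. The
  intervals tagged in \<open>N\<close> lie in an open set \<open>G\<close> of measure below
  \<open>\<delta>\<close>, where absolute continuity keeps the total increment below
  \<open>e\<close>. A tagged division fine for the combined gauge adds up both
  contributions.\<close>

lemma absolutely_continuous_fun_on_derivative_bound:
  assumes ac: "absolutely_continuous_fun_on a b f" and N: "negligible N"
    and der: "\<And>t. t \<in> {a..b} - N \<Longrightarrow>
      \<exists>D. (f has_real_derivative D) (at t within {a..b}) \<and> \<bar>D\<bar> \<le> B"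
    and cd: "a \<le> c" "c \<le> d" "d \<le> b"
  shows "\<bar>f d - f c\<bar> \<le> B * (d - c)"
proof -
  have key: "\<bar>f d - f c\<bar> \<le> (B + e) * (d - c) + e" if "e > 0" for e
  proof -
    have "\<exists>\<delta>>0. \<forall>D. finite D \<longrightarrow> (\<forall>(u, w)\<in>D. a \<le> u \<and> u \<le> w \<and> w \<le> b) \<longrightarrow>
        disjoint_family_on (\<lambda>(u, w). {u<..<w}) D \<longrightarrow>
        (\<Sum>(u, w)\<in>D. w - u) < \<delta> \<longrightarrow> (\<Sum>(u, w)\<in>D. \<bar>f w - f u\<bar>) < e"
      using ac[unfolded absolutely_continuous_fun_on_def, rule_format, OF \<open>e > 0\<close>] .
    then obtain \<delta> where \<delta>: "\<delta> > 0" and \<delta>_sum: "\<forall>D. finite D \<longrightarrow> (\<forall>(u, w)\<in>D. a \<le> u \<and> u \<le> w \<and> w \<le> b) \<longrightarrow>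
        disjoint_family_on (\<lambda>(u, w). {u<..<w}) D \<longrightarrow>
        (\<Sum>(u, w)\<in>D. w - u) < \<delta> \<longrightarrow> (\<Sum>(u, w)\<in>D. \<bar>f w - f u\<bar>) < e"
      by (elim exE conjE)
    have N0: "N \<in> null_sets lebesgue" using N by (simp add: negligible_iff_null_sets)
    obtain G where G: "open G" "N \<subseteq> G" "emeasure lebesgue (G - N) < ennreal \<delta>"
      using sets_lebesgue_outer_open[OF null_setsD2[OF N0] \<delta>] by metis
    have "emeasure lebesgue G = emeasure lebesgue (G - N)"
      using G(1) by (intro emeasure_Diff_null_set[OF N0, symmetric]) simp
    then have Gd: "emeasure lebesgue G < ennreal \<delta>" using G(3) by simp
    then have Gl: "G \<in> lmeasurable"
      using G(1) order.strict_trans[OF Gd ennreal_less_top] by (intro fmeasurableI) auto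
    have Gm: "measure lebesgue G < \<delta>"
      using Gd Gl \<delta> by (simp add: emeasure_eq_measure2 ennreal_less_iff)
    have "\<exists>r>0. \<forall>y\<in>{a..b}. \<bar>y - t\<bar> < r \<longrightarrow> \<bar>f y - f t\<bar> \<le> (B + e) * \<bar>y - t\<bar>" if t: "t \<in> {a..b} - N" for t
      using der[OF t] has_real_derivative_imp_local_bound \<open>e > 0\<close> by blast
    then obtain r where r: "\<And>t. t \<in> {a..b} - N \<Longrightarrow> r t > 0 \<and>
        (\<forall>y\<in>{a..b}. \<bar>y - t\<bar> < r t \<longrightarrow> \<bar>f y - f t\<bar> \<le> (B + e) * \<bar>y - t\<bar>)"
      by metis
    define g where "g t = (if t \<in> N then G else if t \<in> {a..b} then ball t (r t) else UNIV)" for t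
    have "gauge g"
      using r G(1,2) by (auto simp: gauge_def g_def)
    then obtain p where p: "p tagged_division_of {c..d}" "g fine p"
      by (rule fine_division_exists_real)
    have finp: "finite p" using p(1) by blast
    have pK: "\<exists>u v. K = {u..v} \<and> u \<le> x \<and> x \<le> v \<and> c \<le> u \<and> v \<le> d \<and> K \<subseteq> g x" if xK: "(x, K) \<in> p" for x K
    proof -
      obtain u v where "K = cbox u v" "x \<in> K" "K \<subseteq> {c..d}"
        using tagged_division_ofD(2)[OF p(1) xK] tagged_division_ofD(3)[OF p(1) xK] tagged_division_ofD(4)[OF p(1) xK] by blast
      moreover have "K \<subseteq> g x" using p(2) xK by (auto simp: fine_def)
      ultimately show ?thesis by (auto simp: box_real)
    qed
    \<comment> \<open>Degenerate intervals are left out: they carry no increment, and an interval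
      with nonempty interior determines its tag, so passing to end points is injective on
      \<open>p1\<close>.\<close>
    define p1 where "p1 = {(x, K) \<in> p. x \<in> N \<and> Inf K < Sup K}"
    have p1: "p1 \<subseteq> p" "finite p1" using finp by (auto simp: p1_def intro: finite_subset)
    have inj: "inj_on (\<lambda>(x, K). (Inf K, Sup K)) p1"
    proof (rule inj_onI, clarify)
      fix x K y L assume 1: "(x, K) \<in> p1" "(y, L) \<in> p1" and e: "Inf K = Inf L" "Sup K = Sup L"
      obtain u v u' v' where *: "K = {u..v}" "L = {u'..v'}" "u \<le> v" "u' \<le> v'"
        using 1 pK p1(1) by (metis order_trans subsetD)
      then have KL: "K = L" using e by simp
      moreover have "x = y"
      proof (rule ccontr)
        assume "x \<noteq> y"
        then have "interior K \<inter> interior L = {}"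
          using tagged_division_ofD(5)[OF p(1)] 1 p1(1) by blast
        then show False using KL * 1 by (auto simp: p1_def)
      qed
      ultimately show "x = y \<and> K = L" by simp
    qed
    define D where "D = (\<lambda>(x, K). (Inf K, Sup K)) ` p1"
    have Dm: "\<exists>x. (x, {u..w}) \<in> p1 \<and> u < w \<and> {u..w} \<subseteq> G \<and> c \<le> u \<and> w \<le> d" if uw: "(u, w) \<in> D" for u w
    proof -
      obtain x K where xK: "(x, K) \<in> p1" "u = Inf K" "w = Sup K" using uw by (auto simp: D_def)
      then have "x \<in> N" "u < w" "(x,K) \<in> p" by (auto simp: p1_def)
      then show ?thesis using pK[of x K] xK by (fastforce simp: g_def)
    qed
    have Dfin: "finite D" using p1 by (simp add: D_def)
    have disj: "disjoint_family_on (\<lambda>(u, w). {u<..<w}) D"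
    proof (unfold disjoint_family_on_def, intro ballI impI)
      fix i j assume ij: "i \<in> D" "j \<in> D" "i \<noteq> j"
      obtain u w u' w' where eq: "i = (u, w)" "j = (u', w')" by fastforce
      then have 1: "(u, w) \<in> D" "(u', w') \<in> D" and ne: "u = u' \<longrightarrow> w \<noteq> w'" using ij by auto
      obtain x x' where x: "(x, {u..w}) \<in> p1" "(x', {u'..w'}) \<in> p1" "u < w" "u' < w'"
        using Dm 1 by meson
      then have "{u..w} \<noteq> {u'..w'}" using ne by (auto simp: Icc_eq_Icc)
      then have "interior {u..w} \<inter> interior {u'..w'} = {}"
        using tagged_division_ofD(5)[OF p(1), of x "{u..w}" x' "{u'..w'}"] x p1(1) by auto
      then show "(\<lambda>(u, w). {u<..<w}) i \<inter> (\<lambda>(u, w). {u<..<w}) j = {}" by (simp add: eq)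
    qed
    have "(\<Sum>(u, w)\<in>D. w - u) = (\<Sum>i\<in>D. measure lebesgue ((\<lambda>(u, w). {u<..<w}) i))"
      by (intro sum.cong) (auto dest!: Dm)
    also have "\<dots> = measure lebesgue (\<Union>i\<in>D. (\<lambda>(u, w). {u<..<w}) i)"
      using Dfin disj by (intro measure_finite_Union[symmetric]) (auto dest!: Dm)
    also have "\<dots> \<le> measure lebesgue G"
    proof (rule measure_mono_fmeasurable[OF _ _ Gl])
      show "(\<Union>i\<in>D. (\<lambda>(u, w). {u<..<w}) i) \<subseteq> G" by (fastforce dest: Dm)
      show "(\<Union>i\<in>D. (\<lambda>(u, w). {u<..<w}) i) \<in> sets lebesgue"
        using Dfin by (intro sets.finite_UN) auto
    qed
    also have "\<dots> < \<delta>" by (rule Gm)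
    finally have "(\<Sum>(u, w)\<in>D. w - u) < \<delta>" .
    then have "(\<Sum>(u, w)\<in>D. \<bar>f w - f u\<bar>) < e"
      using Dm cd Dfin disj by (intro \<delta>_sum[rule_format]) fastforce+
    then have s1: "(\<Sum>(x, K)\<in>p1. \<bar>f (Sup K) - f (Inf K)\<bar>) < e"
      unfolding D_def by (subst (asm) sum.reindex[OF inj]) (simp add: case_prod_beta o_def)
    have Be: "0 \<le> (B + e) * (Sup K - Inf K)" and s2': "(x, K) \<notin> p1 \<Longrightarrow> \<bar>f (Sup K) - f (Inf K)\<bar> \<le> (B + e) * (Sup K - Inf K)"
      if xK: "(x, K) \<in> p" and B: "B \<ge> 0" for x K
    proof -
      obtain u v where uv: "K = {u..v}" "u \<le> x" "x \<le> v" "c \<le> u" "v \<le> d" "K \<subseteq> g x"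
        using pK[OF xK] by blast
      show "0 \<le> (B + e) * (Sup K - Inf K)" using uv B \<open>e > 0\<close> by simp
      assume "(x, K) \<notin> p1"
      then consider "u = v" | "x \<notin> N" using uv xK by (fastforce simp: p1_def)
      then show "\<bar>f (Sup K) - f (Inf K)\<bar> \<le> (B + e) * (Sup K - Inf K)"
      proof cases
        case 1
        then show ?thesis using uv by simp
      next
        case 2
        then have x: "x \<in> {a..b} - N" using uv cd by auto
        then have "K \<subseteq> ball x (r x)" using uv(6) by (simp add: g_def)
        then have "u \<in> ball x (r x)" "v \<in> ball x (r x)" using uv by (blast intro: atLeastAtMost_iff[THEN iffD2] order_trans)+
        then have "\<bar>f u - f x\<bar> \<le> (B + e) * \<bar>u - x\<bar>" "\<bar>f v - f x\<bar> \<le> (B + e) * \<bar>v - x\<bar>"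
          using r[OF x] uv cd
          by (metis atLeastAtMost_iff dist_commute dist_real_def mem_ball order_trans)+
        then have "\<bar>f v - f u\<bar> \<le> (B + e) * (v - u)" using uv by (simp add: algebra_simps)
        then show ?thesis using uv by simp
      qed
    qed
    \<comment> \<open>The sign of \<open>B\<close> is not given, but it is needed to enlarge the sum
      over \<open>p - p1\<close> to one over \<open>p\<close>. A nondegenerate interval is not
      negligible, so the derivative bound applies at some point of it.\<close>
    have B: "B \<ge> 0" if "c < d"
    proof (rule ccontr)
      assume "\<not> 0 \<le> B"
      have "t \<in> N" if t: "t \<in> {c..d}" for t
      proof (rule ccontr)
        assume "t \<notin> N"
        then obtain D where "\<bar>D\<bar> \<le> B" using der[of t] t cd by auto
        then show False using \<open>\<not> 0 \<le> B\<close> by linarith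
      qed
      then have "{c..d} \<subseteq> N" by blast
      then have "negligible {c..d}" using N negligible_subset by blast
      then show False using that by (simp add: negligible_interval(1)[where 'a=real, simplified box_real])
    qed
    show ?thesis
    proof (cases "c < d")
      case True
      note B = B[OF True]
      have "\<bar>f d - f c\<bar> = \<bar>\<Sum>(x, K)\<in>p. f (Sup K) - f (Inf K)\<bar>"
        using additive_tagged_division_1[OF cd(2) p(1), of f] by simp
      also have "\<dots> \<le> (\<Sum>(x, K)\<in>p. \<bar>f (Sup K) - f (Inf K)\<bar>)"
        by (rule order_trans[OF sum_abs]) (simp add: case_prod_beta)
      also have "\<dots> = (\<Sum>(x, K)\<in>p - p1. \<bar>f (Sup K) - f (Inf K)\<bar>) + (\<Sum>(x, K)\<in>p1. \<bar>f (Sup K) - f (Inf K)\<bar>)"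
        by (rule sum.subset_diff[OF p1(1) finp])
      also have "\<dots> \<le> (\<Sum>(x, K)\<in>p - p1. (B + e) * (Sup K - Inf K)) + e"
        using s1 s2' B by (intro add_mono sum_mono) auto
      also have "(\<Sum>(x, K)\<in>p - p1. (B + e) * (Sup K - Inf K)) \<le> (\<Sum>(x, K)\<in>p. (B + e) * (Sup K - Inf K))"
        using Be B finp by (intro sum_mono2) auto
      also have "\<dots> = (B + e) * (\<Sum>(x, K)\<in>p. Sup K - Inf K)"
        by (simp add: sum_distrib_left case_prod_beta)
      also have "(\<Sum>(x, K)\<in>p. Sup K - Inf K) = d - c"
        using additive_tagged_division_1[OF cd(2) p(1), of "\<lambda>x. x"] by simp
      finally show ?thesis by simp
    next
      case False
      then show ?thesis using cd \<open>e > 0\<close> by simp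
    qed
  qed
  show ?thesis
  proof (rule field_le_epsilon)
    fix e :: real assume "e > 0"
    \<comment> \<open>Chosen so that the two error terms \<open>e' * (d - c)\<close> and
      \<open>e'\<close> add up to exactly \<open>e\<close>.\<close>
    define e' where "e' = e / (d - c + 1)"
    have "e' > 0" using \<open>e > 0\<close> cd by (simp add: e'_def)
    have "(B + e') * (d - c) + e' = B * (d - c) + e' * (d - c + 1)" by (simp add: algebra_simps)
    also have "\<dots> = B * (d - c) + e" using cd by (simp add: e'_def)
    finally show "\<bar>f d - f c\<bar> \<le> B * (d - c) + e" using key[OF \<open>e' > 0\<close>] by simp
  qed
qed

section \<open>Lebesgue differentiation on the line\<close>

text \<open>Vitali covering combined with Henstock's lemma. Each bad point \<open>t\<close> is an
  end point of arbitrarily short intervals inside the gauge whose Riemann defect is at least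
  \<open>e\<close> times their length. Henstock's lemma bounds the total defect of a finite disjoint
  family by \<open>e * \<eta>\<close>, hence its total length by \<open>\<eta>\<close>, while a
  countable disjoint family already covers almost all bad points.\<close>

lemma negligible_difference_quotient_defect:
  fixes f :: "real \<Rightarrow> real"
  assumes f: "f integrable_on {a..b}" and e: "e > 0"
  shows "negligible {t \<in> {a..b}. \<forall>\<delta>>0. \<exists>y\<in>{a..b}. y \<noteq> t \<and> \<bar>y - t\<bar> < \<delta> \<and>
     e * \<bar>y - t\<bar> \<le> \<bar>integral {a..y} f - integral {a..t} f - f t * (y - t)\<bar>}" (is "negligible ?S")
proof (subst negligible_outer_le, intro allI impI)
  fix \<eta> :: real assume \<eta>: "\<eta> > 0"
  define F where "F t = integral {a..t} f" for t
  obtain \<gamma> where \<gamma>: "gauge \<gamma>"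
    "\<And>p. p tagged_partial_division_of (cbox a b) \<Longrightarrow> \<gamma> fine p \<Longrightarrow>
      (\<Sum>(x, K)\<in>p. norm (measure lborel K *\<^sub>R f x - integral K f)) < e * \<eta>"
    using Henstock_lemma[of f a b "e * \<eta>"] f e \<eta> by (auto simp: box_real)
  \<comment> \<open>The covering is by closed balls, but the tag \<open>t\<close> must be an end
    point of its interval, not the centre. The index is therefore the pair of the tag and the other
    end, and \<open>cc\<close>, \<open>rr\<close> give centre and radius of the interval between
    them.\<close>
  define cc where "cc = (\<lambda>(t::real, y::real). (t + y) / 2)"
  define rr where "rr = (\<lambda>(t::real, y::real). \<bar>y - t\<bar> / 2)"
  have ball: "cball (cc (t, y)) (rr (t, y)) = {min t y..max t y}" for t y
    by (auto simp: cc_def rr_def dist_real_def abs_if min_def max_def field_simps split: if_splits)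
  define K where "K = {(t, y). t \<in> {a..b} \<and> y \<in> {a..b} \<and> y \<noteq> t \<and> {min t y..max t y} \<subseteq> \<gamma> t \<and>
     e * \<bar>y - t\<bar> \<le> \<bar>F y - F t - f t * (y - t)\<bar>}"
  have Kpos: "0 < rr i" if "i \<in> K" for i using that by (auto simp: K_def rr_def)
  have Kcov: "\<exists>i. i \<in> K \<and> t \<in> cball (cc i) (rr i) \<and> rr i < d" if t: "t \<in> ?S" and d: "0 < d" for t d
  proof -
    obtain s where s: "s > 0" "ball t s \<subseteq> \<gamma> t"
      using \<gamma>(1) unfolding gauge_def by (meson openE)
    from t have "\<forall>\<delta>>0. \<exists>y\<in>{a..b}. y \<noteq> t \<and> \<bar>y - t\<bar> < \<delta> \<and> e * \<bar>y - t\<bar> \<le> \<bar>F y - F t - f t * (y - t)\<bar>"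
      by (simp add: F_def)
    then obtain y where y: "y \<in> {a..b}" "y \<noteq> t" "\<bar>y - t\<bar> < min s d"
       "e * \<bar>y - t\<bar> \<le> \<bar>F y - F t - f t * (y - t)\<bar>"
      using s(1) d by (meson min_less_iff_conj)
    have "{min t y..max t y} \<subseteq> ball t s" using y(3) by (auto simp: dist_real_def)
    then have "(t, y) \<in> K" using t y s by (auto simp: K_def)
    moreover have "t \<in> cball (cc (t, y)) (rr (t, y))" by (simp add: ball)
    moreover have "rr (t, y) < d" using y(3) d by (simp add: rr_def)
    ultimately show ?thesis by blast
  qed
  obtain C where C: "countable C" "C \<subseteq> K"
    "pairwise (\<lambda>i j. disjnt (cball (cc i) (rr i)) (cball (cc j) (rr j))) C"
    "negligible (?S - (\<Union>i\<in>C. cball (cc i) (rr i)))"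
    by (rule Vitali_covering_theorem_cballs[of K rr ?S cc, OF Kpos Kcov])
  \<comment> \<open>The bound does not depend on the finite subfamily \<open>D\<close>, so it
    carries over to the whole countable union.\<close>
  have sum_le: "measure lebesgue (\<Union>i\<in>D. cball (cc i) (rr i)) \<le> \<eta>" if D: "D \<subseteq> C" "finite D" for D
  proof -
    define p where "p = (\<lambda>i. (fst i, cball (cc i) (rr i))) ` D"
    have disj: "disjnt (cball (cc i) (rr i)) (cball (cc j) (rr j))" if "i \<in> D" "j \<in> D" "i \<noteq> j" for i j
      using C(3) that D(1) by (auto simp: pairwise_def)
    have ne: "cball (cc i) (rr i) \<noteq> {}" if "i \<in> D" for i
      using Kpos[of i] that C(2) D(1) by (auto simp: not_less)
    have inj: "inj_on (\<lambda>i. (fst i, cball (cc i) (rr i))) D"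
    proof (rule inj_onI)
      fix i j assume "i \<in> D" "j \<in> D" "(fst i, cball (cc i) (rr i)) = (fst j, cball (cc j) (rr j))"
      then show "i = j" using disj[of i j] ne[of j] by (metis Pair_inject disjnt_self_iff_empty)
    qed
    have part: "p tagged_partial_division_of (cbox a b)"
    proof (unfold tagged_partial_division_of_def, intro conjI allI impI; (elim conjE)?)
      show "finite p" using D by (simp add: p_def)
      show "x \<in> L" "L \<subseteq> cbox a b" "\<exists>a b. L = cbox a b" if xL: "(x, L) \<in> p" for x L
      proof -
        obtain y where xy: "(x, y) \<in> D" "L = {min x y..max x y}" using xL by (auto simp: p_def ball)
        then have "(x, y) \<in> K" using C(2) D(1) by blast
        then show "x \<in> L" "L \<subseteq> cbox a b" "\<exists>a b. L = cbox a b" using xy by (auto simp: K_def box_real)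
      qed
      show "interior K1 \<inter> interior K2 = {}"
        if x12: "(x1, K1) \<in> p" "(x2, K2) \<in> p" "(x1, K1) \<noteq> (x2, K2)" for x1 K1 x2 K2
      proof -
        obtain i j where "i \<in> D" "j \<in> D" "K1 = cball (cc i) (rr i)" "K2 = cball (cc j) (rr j)" "i \<noteq> j"
          using x12 unfolding p_def by fastforce
        then have "disjnt K1 K2" using disj by blast
        then show ?thesis using interior_subset by (fastforce simp: disjnt_def)
      qed
    qed
    have fine: "\<gamma> fine p"
    proof (rule fineI)
      fix x L assume "(x, L) \<in> p"
      then obtain y where xy: "(x, y) \<in> D" "L = {min x y..max x y}" by (auto simp: p_def ball)
      then show "L \<subseteq> \<gamma> x" using C(2) D(1) by (auto simp: K_def)
    qed
    have local_le: "e * measure lebesgue (cball (cc i) (rr i)) \<le>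
       norm (measure lborel (cball (cc i) (rr i)) *\<^sub>R f (fst i) - integral (cball (cc i) (rr i)) f)" if "i \<in> D" for i
    proof -
      obtain t y where i: "i = (t, y)" by fastforce
      then have ty: "t \<in> {a..b}" "y \<in> {a..b}" "e * \<bar>y - t\<bar> \<le> \<bar>F y - F t - f t * (y - t)\<bar>"
        using that C(2) D(1) by (auto simp: K_def)
      have sub: "F u + integral {u..v} f = F v" if "u \<in> {a..b}" "v \<in> {a..b}" "u \<le> v" for u v
        unfolding F_def using that f
        by (intro Henstock_Kurzweil_Integration.integral_combine) (auto intro: integrable_subinterval_real)
      have "\<bar>F y - F t - f t * (y - t)\<bar> = \<bar>\<bar>y - t\<bar> * f t - integral {min t y..max t y} f\<bar>"
        using sub[of t y] sub[of y t] ty by (cases "t \<le> y") (auto simp: algebra_simps)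
      moreover have "measure lborel {min t y..max t y} = \<bar>y - t\<bar>" by auto
      ultimately show ?thesis using ty(3) by (simp add: i ball)
    qed
    have "e * measure lebesgue (\<Union>i\<in>D. cball (cc i) (rr i)) \<le> e * (\<Sum>i\<in>D. measure lebesgue (cball (cc i) (rr i)))"
      using e D by (intro mult_left_mono measure_UNION_le) auto
    also have "\<dots> \<le> (\<Sum>i\<in>D. norm (measure lborel (cball (cc i) (rr i)) *\<^sub>R f (fst i) - integral (cball (cc i) (rr i)) f))"
      using local_le by (simp add: sum_distrib_left sum_mono)
    also have "\<dots> = (\<Sum>(x, L)\<in>p. norm (measure lborel L *\<^sub>R f x - integral L f))"
      unfolding p_def by (subst sum.reindex[OF inj]) simp
    also have "\<dots> < e * \<eta>" by (rule \<gamma>(2)[OF part fine])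
    finally show ?thesis using e by simp
  qed
  have m: "cball (cc i) (rr i) \<in> lmeasurable" for i by simp
  note U = fmeasurable_UN_bound[OF C(1) m sum_le] measure_UN_bound[OF C(1) m sum_le]
  have N: "?S - (\<Union>i\<in>C. cball (cc i) (rr i)) \<in> null_sets lebesgue"
    using C(4) by (simp add: negligible_iff_null_sets)
  show "\<exists>T. ?S \<subseteq> T \<and> T \<in> lmeasurable \<and> measure lebesgue T \<le> \<eta>"
  proof (intro exI conjI)
    let ?U = "\<Union>i\<in>C. cball (cc i) (rr i)"
    show "?S \<subseteq> ?U \<union> (?S - ?U)" by blast
    show "?U \<union> (?S - ?U) \<in> lmeasurable"
      by (rule fmeasurable.Un[OF U(1) negligible_imp_measurable[OF C(4)]])
    have "measure lebesgue (?U \<union> (?S - ?U)) = measure lebesgue ?U"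
      using U(1) N by (intro measure_Un_null_set) auto
    then show "measure lebesgue (?U \<union> (?S - ?U)) \<le> \<eta>" using U(2) by simp
  qed
qed

text \<open>The points where the derivative fails form the countable union of the negligible defect
  sets for the tolerances \<open>1 / (n + 1)\<close>.\<close>

lemma indefinite_integral_has_real_derivative_AE:
  fixes f :: "real \<Rightarrow> real"
  assumes f: "f integrable_on {a..b}"
  shows "\<exists>N. negligible N \<and>
    (\<forall>t\<in>{a..b} - N. ((\<lambda>t. integral {a..t} f) has_real_derivative f t) (at t within {a..b}))"
proof -
  define F where "F t = integral {a..t} f" for t
  define S where "S e = {t \<in> {a..b}. \<forall>\<delta>>0. \<exists>y\<in>{a..b}. y \<noteq> t \<and> \<bar>y - t\<bar> < \<delta> \<and>
     e * \<bar>y - t\<bar> \<le> \<bar>F y - F t - f t * (y - t)\<bar>}" for e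
  have "negligible (S (inverse (real (Suc n))))" for n
    unfolding S_def F_def by (rule negligible_difference_quotient_defect[OF f]) simp
  then have neg: "negligible (\<Union>n. S (inverse (real (Suc n))))" by (rule negligible_Union_nat)
  have "(F has_real_derivative f t) (at t within {a..b})"
    if t: "t \<in> {a..b} - (\<Union>n. S (inverse (real (Suc n))))" for t
    unfolding has_field_derivative_def has_derivative_within_alt
  proof (intro conjI allI impI)
    show "bounded_linear ((*) (f t))" by (rule bounded_linear_mult_right)
    fix e :: real assume "0 < e"
    then obtain n where n: "inverse (real (Suc n)) < e" using reals_Archimedean by blast
    then have "t \<notin> S (inverse (real (Suc n)))" using t by blast
    then obtain \<delta> where \<delta>: "\<delta> > 0" "\<And>y. y \<in> {a..b} \<Longrightarrow> y \<noteq> t \<Longrightarrow> \<bar>y - t\<bar> < \<delta> \<Longrightarrow>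
        \<bar>F y - F t - f t * (y - t)\<bar> < inverse (real (Suc n)) * \<bar>y - t\<bar>"
      using t unfolding S_def by (smt (verit, best) DiffD1 mem_Collect_eq)
    have "norm (F y - F t - f t * (y - t)) \<le> e * norm (y - t)" if "y \<in> {a..b}" "norm (y - t) < \<delta>" for y
    proof (cases "y = t")
      case False
      then have "\<bar>F y - F t - f t * (y - t)\<bar> < inverse (real (Suc n)) * \<bar>y - t\<bar>" using \<delta>(2) that by simp
      also have "\<dots> \<le> e * \<bar>y - t\<bar>" using n by (intro mult_right_mono) auto
      finally show ?thesis by simp
    qed simp
    then show "\<exists>\<delta>>0. \<forall>y\<in>{a..b}. norm (y - t) < \<delta> \<longrightarrow> norm (F y - F t - f t * (y - t)) \<le> e * norm (y - t)"
      using \<delta>(1) by blast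
  qed
  then show ?thesis using neg unfolding F_def by blast
qed

section \<open>Transported measures\<close>

lemma finite_borel_measure_on_integrable:
  fixes f :: "real \<Rightarrow> real"
  assumes M: "finite_borel_measure_on I M" and f: "f \<in> borel_measurable (restrict_space borel I)"
    and B: "\<And>x. x \<in> I \<Longrightarrow> \<bar>f x\<bar> \<le> B"
  shows "integrable M f"
proof -
  interpret finite_measure M by (rule finite_borel_measure_onD(1)[OF M])
  have "f \<in> borel_measurable M"
    using f by (simp add: measurable_cong_sets[OF finite_borel_measure_onD(2)[OF M] refl])
  then show ?thesis
    using B finite_borel_measure_onD(3)[OF M] by (intro integrable_const_bound[where B = B]) auto
qed

lemma finite_borel_measure_on_integral_bound:
  fixes f :: "real \<Rightarrow> real"
  assumes M: "finite_borel_measure_on I M" and f: "f \<in> borel_measurable (restrict_space borel I)"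
    and B: "\<And>x. x \<in> I \<Longrightarrow> \<bar>f x\<bar> \<le> B"
  shows "\<bar>LINT x|M. f x\<bar> \<le> B * measure M I"
proof -
  interpret finite_measure M by (rule finite_borel_measure_onD(1)[OF M])
  have "\<bar>LINT x|M. f x\<bar> \<le> (LINT x|M. \<bar>f x\<bar>)" by (rule integral_abs_bound)
  also have "\<dots> \<le> (LINT x|M. B)"
    using B finite_borel_measure_onD(3)[OF M] finite_borel_measure_on_integrable[OF M f B]
    by (intro integral_mono) auto
  also have "\<dots> = B * measure M I" by (simp add: finite_borel_measure_onD(3)[OF M])
  finally show ?thesis .
qed

lemma finite_borel_measure_on_integral_diff_bound:
  fixes f g :: "real \<Rightarrow> real"
  assumes M: "finite_borel_measure_on I M"
    and f: "f \<in> borel_measurable (restrict_space borel I)" "\<And>x. x \<in> I \<Longrightarrow> \<bar>f x\<bar> \<le> B"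
    and g: "g \<in> borel_measurable (restrict_space borel I)"
    and d: "\<And>x. x \<in> I \<Longrightarrow> \<bar>f x - g x\<bar> \<le> D"
  shows "\<bar>(LINT x|M. f x) - (LINT x|M. g x)\<bar> \<le> D * measure M I"
proof -
  have "\<bar>g x\<bar> \<le> B + D" if "x \<in> I" for x using f(2)[OF that] d[OF that] by linarith
  then have "(LINT x|M. f x) - (LINT x|M. g x) = (LINT x|M. f x - g x)"
    using finite_borel_measure_on_integrable[OF M f] finite_borel_measure_on_integrable[OF M g]
    by (intro Bochner_Integration.integral_diff[symmetric]) auto
  also have "\<bar>\<dots>\<bar> \<le> D * measure M I"
    using f g by (intro finite_borel_measure_on_integral_bound[OF M _ d]) auto
  finally show ?thesis .
qed

section \<open>Lipschitz tests and the transport representation\<close>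

text \<open>Vanishing from 1 on ignores mass that has left the domain. Vanishing on
  \<open>{..0}\<close> ignores mass that has not yet entered and makes new mass count
  continuously.\<close>

definition lipschitz_tests :: "(real \<Rightarrow> real) set" where
  "lipschitz_tests = {g. (\<exists>L. L-lipschitz_on UNIV g) \<and> (\<forall>x. x \<notin> {0<..<1} \<longrightarrow> g x = 0)}"

lemma lipschitz_on_UNIV_realD:
  fixes g :: "real \<Rightarrow> real"
  assumes "L-lipschitz_on UNIV g"
  shows "\<bar>g x - g y\<bar> \<le> L * \<bar>x - y\<bar>" "L \<ge> 0" "continuous_on S g" "g \<in> borel_measurable borel"
proof -
  show "\<bar>g x - g y\<bar> \<le> L * \<bar>x - y\<bar>" "L \<ge> 0"
    using lipschitz_onD[OF assms, of x y] lipschitz_on_nonneg[OF assms] by (auto simp: dist_real_def)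
  have "continuous_on UNIV g" by (rule lipschitz_on_continuous_on[OF assms])
  then show "continuous_on S g" "g \<in> borel_measurable borel"
    by (auto intro: continuous_on_subset borel_measurable_continuous_onI)
qed

lemma lipschitz_tests_bound:
  fixes g :: "real \<Rightarrow> real"
  assumes "L-lipschitz_on UNIV g" "\<forall>x. x \<notin> {0<..<1} \<longrightarrow> g x = 0"
  shows "\<bar>g x\<bar> \<le> L"
proof (cases "x \<in> {0<..<1::real}")
  case True
  have "\<bar>g x\<bar> \<le> L * \<bar>x\<bar>" using lipschitz_on_UNIV_realD(1)[OF assms(1), of x 0] assms(2) by simp
  also have "\<dots> \<le> L * 1" using True lipschitz_on_UNIV_realD(2)[OF assms(1)] by (intro mult_left_mono) auto
  finally show ?thesis by simp
next
  case False
  then show ?thesis using assms lipschitz_on_UNIV_realD(2)[OF assms(1)] by simp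
qed

text \<open>\<open>A t - A s\<close> is the distance travelled during \<open>[s, t]\<close> by every particle present.\<close>

definition admissible_displacement :: "real \<Rightarrow> (real \<Rightarrow> real) \<Rightarrow> bool" where
  "admissible_displacement T A \<longleftrightarrow>
     (\<forall>s t. 0 \<le> s \<longrightarrow> s \<le> t \<longrightarrow> t \<le> T \<longrightarrow> 0 \<le> A t - A s \<and> A t - A s \<le> t - s)"

text \<open>The common form to which both notions of solution are reduced; the flow enters only
  through the displacement \<open>A\<close>.\<close>

definition transported_by ::
    "real \<Rightarrow> (real \<Rightarrow> real) \<Rightarrow> real measure \<Rightarrow> real measure \<Rightarrow> (real \<Rightarrow> real measure) \<Rightarrow> bool" where
  "transported_by T A \<rho>0 \<mu> \<rho> \<longleftrightarrow>
     (\<forall>t\<in>{0..T}. \<forall>g\<in>lipschitz_tests.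
        (LINT x|\<rho> t. g x) = (LINT x|\<rho>0. g (x + A t)) + (LINT s:{0<..t}|\<mu>. g (A t - A s)))"

lemma admissible_displacement_abs:
  assumes "admissible_displacement T A" "s \<in> {0..T}" "t \<in> {0..T}"
  shows "\<bar>A t - A s\<bar> \<le> \<bar>t - s\<bar>"
proof -
  have "0 \<le> A t - A s \<and> A t - A s \<le> t - s" if "s \<le> t" "s \<in> {0..T}" "t \<in> {0..T}" for s t
    using assms(1) that by (auto simp: admissible_displacement_def)
  from this[of s t] this[of t s] show ?thesis using assms(2,3) by linarith
qed

lemma admissible_displacement_continuous:
  assumes "admissible_displacement T A"
  shows "continuous_on {0..T} A"
proof -
  have "1-lipschitz_on {0..T} A"
    using admissible_displacement_abs[OF assms] by (intro lipschitz_onI) (auto simp: dist_real_def)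
  then show ?thesis by (rule lipschitz_on_continuous_on)
qed

lemma admissible_displacement_measurable:
  assumes "admissible_displacement T A" "I \<subseteq> {0..T}"
  shows "A \<in> borel_measurable (restrict_space borel I)"
  using continuous_on_subset[OF admissible_displacement_continuous[OF assms(1)] assms(2)]
  by (rule borel_measurable_continuous_on_restrict)

text \<open>Between \<open>t0\<close> and \<open>t\<close> every argument of \<open>g\<close> in the
  representation shifts by \<open>A t - A t0\<close>, which is at most
  \<open>\<bar>t - t0\<bar>\<close> in size. Integrating the resulting change of \<open>g\<close>
  over both data measures gives the constant.\<close>

lemma transported_by_integral_lipschitz:
  assumes \<rho>0: "finite_borel_measure_on {0..<1} \<rho>0" and \<mu>: "finite_borel_measure_on {0<..T} \<mu>"
    and A: "admissible_displacement T A" and tr: "transported_by T A \<rho>0 \<mu> \<rho>"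
    and g: "L-lipschitz_on UNIV g" "\<forall>x. x \<notin> {0<..<1} \<longrightarrow> g x = (0::real)"
    and t: "t \<in> {0..T}" "t0 \<in> {0..T}"
  shows "\<bar>(LINT x|\<rho> t. g x) - (LINT x|\<rho> t0. g x)\<bar>
    \<le> L * (measure \<rho>0 {0..<1} + measure \<mu> {0<..T}) * \<bar>t - t0\<bar>"
proof -
  have gT: "g \<in> lipschitz_tests" using g by (auto simp: lipschitz_tests_def)
  have gm: "g \<in> borel_measurable borel" by (rule lipschitz_on_UNIV_realD(4)[OF g(1)])
  have Am: "A \<in> borel_measurable (restrict_space borel {0<..T})"
    by (rule admissible_displacement_measurable[OF A]) auto
  \<comment> \<open>For \<open>s > u\<close> the argument \<open>A u - A s\<close> is nonpositive
    and \<open>g\<close> vanishes there. The influx integral thus runs over a domain independent of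
    \<open>u\<close>, so two times can be compared under one integral.\<close>
  have rep: "(LINT x|\<rho> u. g x) = (LINT x|\<rho>0. g (x + A u)) + (LINT s|\<mu>. g (A u - A s))"
    if u: "u \<in> {0..T}" for u
  proof -
    have "(LINT s:{0<..u}|\<mu>. g (A u - A s)) = (LINT s|\<mu>. g (A u - A s))"
      unfolding set_lebesgue_integral_def
    proof (rule Bochner_Integration.integral_cong[OF refl])
      fix s assume "s \<in> space \<mu>"
      then have s: "s \<in> {0<..T}" by (simp add: finite_borel_measure_onD(3)[OF \<mu>])
      have "g (A u - A s) = 0" if "\<not> s \<le> u"
      proof -
        have "A u - A s \<le> 0" using that s u A by (force simp: admissible_displacement_def)
        then show ?thesis using g(2) by simp
      qed
      then show "indicat_real {0<..u} s *\<^sub>R g (A u - A s) = g (A u - A s)"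
        using s by (cases "s \<le> u") auto
    qed
    then show ?thesis using tr u gT by (auto simp: transported_by_def)
  qed
  have close: "\<bar>g (y + c) - g (z + c)\<bar> \<le> L * \<bar>t - t0\<bar>" if "\<bar>y - z\<bar> \<le> \<bar>t - t0\<bar>" for y z c
  proof -
    have "\<bar>g (y + c) - g (z + c)\<bar> \<le> L * \<bar>y - z\<bar>"
      using lipschitz_on_UNIV_realD(1)[OF g(1), of "y + c" "z + c"] by simp
    then show ?thesis
      using mult_left_mono[OF that lipschitz_on_UNIV_realD(2)[OF g(1)]] by linarith
  qed
  note At = admissible_displacement_abs[OF A t(2,1)]
  have "\<bar>(LINT x|\<rho>0. g (x + A t)) - (LINT x|\<rho>0. g (x + A t0))\<bar> \<le> (L * \<bar>t - t0\<bar>) * measure \<rho>0 {0..<1}"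
    using close[OF At] lipschitz_tests_bound[OF g]
    by (intro finite_borel_measure_on_integral_diff_bound[OF \<rho>0])
      (auto simp: add.commute intro!: measurable_compose[OF _ gm] measurable_restrict_space1)
  moreover have "\<bar>(LINT s|\<mu>. g (A t - A s)) - (LINT s|\<mu>. g (A t0 - A s))\<bar> \<le> (L * \<bar>t - t0\<bar>) * measure \<mu> {0<..T}"
    using close[OF At, of "- A _"] lipschitz_tests_bound[OF g] Am
    by (intro finite_borel_measure_on_integral_diff_bound[OF \<mu>])
      (auto intro!: measurable_compose[OF _ gm])
  ultimately show ?thesis
    unfolding rep[OF t(1)] rep[OF t(2)] by (simp add: algebra_simps)
qed

section \<open>From the representation to continuity for \<open>phi\<close>\<close>

text \<open>Product rule: on \<open>{0..<1}\<close> both factors are 1-Lipschitz and bounded by 1,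
  which gives the constant 2. Across the boundary \<open>hat\<close> tends to 0 at both ends, so the
  extension by 0 creates no jump.\<close>

lemma phi_test_times_hat:
  assumes "f \<in> phi_test_functions"
  shows "2-lipschitz_on UNIV (\<lambda>x. f x * hat x)" "\<forall>x. x \<notin> {0<..<1} \<longrightarrow> f x * hat x = 0"
proof -
  have f: "\<And>x. x \<in> {0..<1} \<Longrightarrow> 0 \<le> f x \<and> f x \<le> 1"
    "\<And>x y. x \<in> {0..<1} \<Longrightarrow> y \<in> {0..<1} \<Longrightarrow> \<bar>f x - f y\<bar> \<le> \<bar>x - y\<bar>"
    using assms by (auto simp: phi_test_functions_def Pi_iff)
  have h: "0 \<le> hat x" "hat x \<le> 1" "\<bar>hat x - hat y\<bar> \<le> \<bar>x - y\<bar>" for x y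
    by (auto simp: hat_def abs_if)
  have h0: "hat x = 0" if "x \<notin> {0..<1}" for x using that by (auto simp: hat_def)
  show "\<forall>x. x \<notin> {0<..<1} \<longrightarrow> f x * hat x = 0"
  proof (intro allI impI)
    fix x :: real assume "x \<notin> {0<..<1}"
    then have "hat x = 0" by (cases "x = 0") (auto simp: hat_def)
    then show "f x * hat x = 0" by simp
  qed
  \<comment> \<open>Outside \<open>{0..<1}\<close> nothing is known about \<open>f\<close>, so this
    case relies on \<open>hat y = 0\<close> and on \<open>f x \<le> 1\<close> at the inner
    point.\<close>
  have out: "\<bar>f x * hat x - f y * hat y\<bar> \<le> 2 * \<bar>x - y\<bar>" if "x \<in> {0..<1}" "y \<notin> {0..<1}" for x y
  proof -
    have "\<bar>f x * hat x\<bar> \<le> 1 * hat x" unfolding abs_mult using f(1)[OF that(1)] h by (intro mult_mono) auto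
    then show ?thesis using h(3)[of x y] h0[OF that(2)] h(1)[of x] by simp
  qed
  have "\<bar>f x * hat x - f y * hat y\<bar> \<le> 2 * \<bar>x - y\<bar>" for x y
  proof (cases "x \<in> {0..<1}"; cases "y \<in> {0..<1}")
    assume xy: "x \<in> {0..<1}" "y \<in> {0..<1}"
    have "f x * hat x - f y * hat y = f x * (hat x - hat y) + (f x - f y) * hat y" by (simp add: algebra_simps)
    also have "\<bar>\<dots>\<bar> \<le> \<bar>f x\<bar> * \<bar>hat x - hat y\<bar> + \<bar>f x - f y\<bar> * \<bar>hat y\<bar>"
      by (metis abs_mult abs_triangle_ineq)
    also have "\<dots> \<le> 1 * \<bar>x - y\<bar> + \<bar>x - y\<bar> * 1"
      using f xy h by (intro add_mono mult_mono) auto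
    finally show ?thesis by simp
  next
    assume "x \<notin> {0..<1}" "y \<in> {0..<1}"
    then show ?thesis using out[of y x] by (simp add: abs_minus_commute)
  next
    assume "x \<in> {0..<1}" "y \<notin> {0..<1}"
    then show ?thesis by (rule out)
  qed (simp add: h0)
  then show "2-lipschitz_on UNIV (\<lambda>x. f x * hat x)"
    by (intro lipschitz_onI) (auto simp: dist_real_def)
qed

text \<open>The supremum is taken in the reals, so the lower bound 0 also depends on the upper bound
  \<open>B\<close>; the zero function makes the family nonempty.\<close>

lemma phi_bound:
  assumes "\<And>f. f \<in> phi_test_functions \<Longrightarrow> \<bar>signed_integral {0..<1} \<nu> (\<lambda>x. f x * hat x)\<bar> \<le> B"
  shows "0 \<le> phi \<nu>" "phi \<nu> \<le> B"
proof -
  have 0: "(\<lambda>x. 0) \<in> phi_test_functions" by (auto simp: phi_test_functions_def)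
  then show "phi \<nu> \<le> B" unfolding phi_def using assms by (intro cSUP_least) auto
  have "bdd_above ((\<lambda>f. \<bar>signed_integral {0..<1} \<nu> (\<lambda>x. f x * hat x)\<bar>) ` phi_test_functions)"
    using assms by (auto intro!: bdd_aboveI2)
  from cSUP_upper[OF 0 this] show "0 \<le> phi \<nu>"
    unfolding phi_def using abs_ge_zero order_trans by blast
qed

lemma transported_by_phi_continuous:
  assumes \<rho>0: "finite_borel_measure_on {0..<1} \<rho>0" and \<mu>: "finite_borel_measure_on {0<..T} \<mu>"
    and \<rho>: "\<forall>t\<in>{0..T}. finite_borel_measure_on {0..<1} (\<rho> t)"
    and A: "admissible_displacement T A" and tr: "transported_by T A \<rho>0 \<mu> \<rho>"
  shows "phi_continuous T \<rho>"
  unfolding phi_continuous_def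
proof
  fix t0 assume t0: "t0 \<in> {0..T}"
  \<comment> \<open>The Lipschitz constant 2 of the products \<open>f x * hat x\<close> times the
    total mass of the data.\<close>
  define C where "C = 2 * (measure \<rho>0 {0..<1} + measure \<mu> {0<..T})"
  have si: "\<bar>signed_integral {0..<1} (measure_diff (\<rho> t) (\<rho> t0)) (\<lambda>x. f x * hat x)\<bar> \<le> C * \<bar>t - t0\<bar>"
    if t: "t \<in> {0..T}" and f: "f \<in> phi_test_functions" for t f
  proof -
    note g = phi_test_times_hat[OF f]
    have "signed_integral {0..<1} (measure_diff (\<rho> t) (\<rho> t0)) (\<lambda>x. f x * hat x)
      = (LINT x|\<rho> t. f x * hat x) - (LINT x|\<rho> t0. f x * hat x)"
      using \<rho> t t0 lipschitz_on_UNIV_realD(4)[OF g(1)] lipschitz_tests_bound[OF g]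
      by (intro signed_integral_eq[where B = 2]) (auto simp: measure_diff_def intro: measurable_restrict_space1)
    then show ?thesis
      using transported_by_integral_lipschitz[OF \<rho>0 \<mu> A tr g t t0] by (simp add: C_def)
  qed
  have b: "0 \<le> phi (measure_diff (\<rho> t) (\<rho> t0))" "phi (measure_diff (\<rho> t) (\<rho> t0)) \<le> C * \<bar>t - t0\<bar>"
    if "t \<in> {0..T}" for t
    using phi_bound[of "measure_diff (\<rho> t) (\<rho> t0)", OF si[OF that]] by blast+
  have ev: "\<forall>\<^sub>F t in at t0 within {0..T}. t \<in> {0..T}" by (simp add: eventually_at_filter)
  have lim: "((\<lambda>t. C * \<bar>t - t0\<bar>) \<longlongrightarrow> 0) (at t0 within {0..T})"
    by (rule tendsto_eq_intros | simp)+
  show "((\<lambda>t. phi (measure_diff (\<rho> t) (\<rho> t0))) \<longlongrightarrow> 0) (at t0 within {0..T})"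
    by (rule tendsto_sandwich[OF _ _ tendsto_const lim])
      (use ev in \<open>eventually_elim, simp add: b\<close>)+
qed

section \<open>Lagrangian solutions\<close>

lemma absolutely_continuous_fun_on_diff:
  assumes f: "absolutely_continuous_fun_on a b f" and g: "absolutely_continuous_fun_on a b g"
  shows "absolutely_continuous_fun_on a b (\<lambda>x. f x - g x)"
  unfolding absolutely_continuous_fun_on_def
proof (intro allI impI)
  fix \<epsilon> :: real assume "\<epsilon> > 0"
  then have e: "\<epsilon> / 2 > 0" by simp
  obtain \<delta>1 where \<delta>1: "\<delta>1 > 0" "\<forall>D. finite D \<longrightarrow> (\<forall>(u, w)\<in>D. a \<le> u \<and> u \<le> w \<and> w \<le> b) \<longrightarrow>
      disjoint_family_on (\<lambda>(u, w). {u<..<w}) D \<longrightarrow> (\<Sum>(u, w)\<in>D. w - u) < \<delta>1 \<longrightarrow>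
      (\<Sum>(u, w)\<in>D. \<bar>f w - f u\<bar>) < \<epsilon> / 2"
    using f[unfolded absolutely_continuous_fun_on_def, rule_format, OF e] by (elim exE conjE)
  obtain \<delta>2 where \<delta>2: "\<delta>2 > 0" "\<forall>D. finite D \<longrightarrow> (\<forall>(u, w)\<in>D. a \<le> u \<and> u \<le> w \<and> w \<le> b) \<longrightarrow>
      disjoint_family_on (\<lambda>(u, w). {u<..<w}) D \<longrightarrow> (\<Sum>(u, w)\<in>D. w - u) < \<delta>2 \<longrightarrow>
      (\<Sum>(u, w)\<in>D. \<bar>g w - g u\<bar>) < \<epsilon> / 2"
    using g[unfolded absolutely_continuous_fun_on_def, rule_format, OF e] by (elim exE conjE)
  show "\<exists>\<delta>>0. \<forall>D. finite D \<longrightarrow> (\<forall>(u, w)\<in>D. a \<le> u \<and> u \<le> w \<and> w \<le> b) \<longrightarrow>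
      disjoint_family_on (\<lambda>(u, w). {u<..<w}) D \<longrightarrow> (\<Sum>(u, w)\<in>D. w - u) < \<delta> \<longrightarrow>
      (\<Sum>(u, w)\<in>D. \<bar>f w - g w - (f u - g u)\<bar>) < \<epsilon>"
  proof (intro exI[of _ "min \<delta>1 \<delta>2"] conjI allI impI)
    show "min \<delta>1 \<delta>2 > 0" using \<delta>1(1) \<delta>2(1) by simp
    fix D :: "(real \<times> real) set"
    assume D: "finite D" "\<forall>(u, w)\<in>D. a \<le> u \<and> u \<le> w \<and> w \<le> b"
      "disjoint_family_on (\<lambda>(u, w). {u<..<w}) D" "(\<Sum>(u, w)\<in>D. w - u) < min \<delta>1 \<delta>2"
    have "(\<Sum>(u, w)\<in>D. \<bar>f w - g w - (f u - g u)\<bar>)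
        \<le> (\<Sum>(u, w)\<in>D. \<bar>f w - f u\<bar>) + (\<Sum>(u, w)\<in>D. \<bar>g w - g u\<bar>)"
      unfolding sum.distrib[symmetric] by (rule sum_mono) auto
    also have "\<dots> < \<epsilon> / 2 + \<epsilon> / 2"
      using \<delta>1(2)[THEN spec[of _ D], THEN mp, OF D(1), THEN mp, OF D(2), THEN mp, OF D(3)] \<delta>2(2)[THEN spec[of _ D], THEN mp, OF D(1), THEN mp, OF D(2), THEN mp, OF D(3)] D(4) by (intro add_strict_mono) auto
    finally show "(\<Sum>(u, w)\<in>D. \<bar>f w - g w - (f u - g u)\<bar>) < \<epsilon>" by simp
  qed
qed

lemma absolutely_continuous_fun_on_subinterval:
  assumes "absolutely_continuous_fun_on a b f" "a \<le> c" "d \<le> b"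
  shows "absolutely_continuous_fun_on c d f"
  unfolding absolutely_continuous_fun_on_def
proof (intro allI impI)
  fix \<epsilon> :: real assume e: "\<epsilon> > 0"
  obtain \<delta> where \<delta>: "\<delta> > 0" "\<forall>D. finite D \<longrightarrow> (\<forall>(u, w)\<in>D. a \<le> u \<and> u \<le> w \<and> w \<le> b) \<longrightarrow>
      disjoint_family_on (\<lambda>(u, w). {u<..<w}) D \<longrightarrow> (\<Sum>(u, w)\<in>D. w - u) < \<delta> \<longrightarrow>
      (\<Sum>(u, w)\<in>D. \<bar>f w - f u\<bar>) < \<epsilon>"
    using assms(1)[unfolded absolutely_continuous_fun_on_def, rule_format, OF e] by (elim exE conjE)
  show "\<exists>\<delta>>0. \<forall>D. finite D \<longrightarrow> (\<forall>(u, w)\<in>D. c \<le> u \<and> u \<le> w \<and> w \<le> d) \<longrightarrow>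
      disjoint_family_on (\<lambda>(u, w). {u<..<w}) D \<longrightarrow> (\<Sum>(u, w)\<in>D. w - u) < \<delta> \<longrightarrow>
      (\<Sum>(u, w)\<in>D. \<bar>f w - f u\<bar>) < \<epsilon>"
    by (intro exI[of _ \<delta>] conjI allI impI \<delta>(1) \<delta>(2)[rule_format]) (use assms(2,3) in fastforce)+
qed

lemma AE_lebesgue_on_negligible:
  assumes "AE t in lebesgue_on S. P t" "S \<in> sets lebesgue"
  shows "\<exists>N. negligible N \<and> (\<forall>t\<in>S - N. P t)"
proof -
  have "AE t in lebesgue. t \<in> S \<longrightarrow> P t"
    using assms by (subst (asm) AE_restrict_space_iff) auto
  then show ?thesis
    unfolding eventually_ae_filter_negligible by blast
qed

lemma velocity_mass_bounds:
  assumes "velocity \<alpha>"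
  shows "0 < \<alpha> (mass \<rho> t)" "\<alpha> (mass \<rho> t) \<le> 1"
  using assms by (auto simp: velocity_def mass_def Pi_iff)

text \<open>Two trajectories have the same velocity at almost every time, whatever their positions,
  so their difference is absolutely continuous with derivative 0 almost everywhere and hence
  constant.\<close>

lemma semiflow_space_homogeneous:
  assumes X: "semiflow T (\<lambda>t x. w t) X" and w: "\<And>t. t \<in> {0..T} \<Longrightarrow> \<bar>w t\<bar> \<le> 1"
  shows "0 \<le> r \<Longrightarrow> r \<le> s \<Longrightarrow> s \<le> t \<Longrightarrow> t \<le> T \<Longrightarrow> 0 \<le> x \<Longrightarrow> \<bar>X t r x - X s r x\<bar> \<le> t - s"
    and "0 \<le> t \<Longrightarrow> t \<le> T \<Longrightarrow> 0 \<le> x \<Longrightarrow> X t 0 x = x + X t 0 0"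
    and "0 \<le> s \<Longrightarrow> s \<le> t \<Longrightarrow> t \<le> T \<Longrightarrow> X t s 0 = X t 0 0 - X s 0 0"
proof -
  have ac: "absolutely_continuous_fun_on r T (\<lambda>t. X t r x)" and init: "X r r x = x"
    if "0 \<le> r" "r \<le> T" "0 \<le> x" for r x
    using X that by (auto simp: semiflow_def)
  have der: "\<exists>N. negligible N \<and> (\<forall>t\<in>{r..T} - N. ((\<lambda>s. X s r x) has_real_derivative w t) (at t within {r..T}))"
    if "0 \<le> r" "r \<le> T" "0 \<le> x" for r x
    using X that by (intro AE_lebesgue_on_negligible) (auto simp: semiflow_def)
  show lip: "\<bar>X t r x - X s r x\<bar> \<le> t - s" if H: "0 \<le> r" "r \<le> s" "s \<le> t" "t \<le> T" "0 \<le> x" for r s t x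
  proof -
    have rT: "r \<le> T" using H by simp
    obtain N where N: "negligible N"
      "\<And>t. t \<in> {r..T} - N \<Longrightarrow> ((\<lambda>s. X s r x) has_real_derivative w t) (at t within {r..T})"
      using der[OF H(1) rT H(5)] by blast
    have "\<bar>X t r x - X s r x\<bar> \<le> 1 * (t - s)"
      using H N(2) w
      by (intro absolutely_continuous_fun_on_derivative_bound[OF ac[OF H(1) rT H(5)] N(1)]) force+
    then show ?thesis by simp
  qed
  \<comment> \<open>The two trajectories may start at different times \<open>q \<le> r\<close>; they
    are compared on the common interval \<open>{r..T}\<close>, to which the derivative on
    \<open>{q..T}\<close> restricts.\<close>
  have const: "X t r x - X t q y = X r r x - X r q y"
    if H: "0 \<le> q" "q \<le> r" "r \<le> t" "t \<le> T" "0 \<le> x" "0 \<le> y" for q r t x y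
  proof -
    have rT: "r \<le> T" "0 \<le> r" "q \<le> T" using H by auto
    obtain N where N: "negligible N"
      "\<And>t. t \<in> {r..T} - N \<Longrightarrow> ((\<lambda>s. X s r x) has_real_derivative w t) (at t within {r..T})"
      using der[OF rT(2,1) H(5)] by blast
    obtain N' where N': "negligible N'"
      "\<And>t. t \<in> {q..T} - N' \<Longrightarrow> ((\<lambda>s. X s q y) has_real_derivative w t) (at t within {q..T})"
      using der[OF H(1) rT(3) H(6)] by blast
    have "((\<lambda>s. X s r x - X s q y) has_real_derivative w t - w t) (at t within {r..T})"
      if "t \<in> {r..T} - (N \<union> N')" for t
      using that H by (intro DERIV_diff N(2) DERIV_subset[OF N'(2)]) auto
    then have d0: "\<exists>D. ((\<lambda>s. X s r x - X s q y) has_real_derivative D) (at t within {r..T}) \<and> \<bar>D\<bar> \<le> 0"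
      if "t \<in> {r..T} - (N \<union> N')" for t
      using that by fastforce
    have "absolutely_continuous_fun_on r T (\<lambda>s. X s r x - X s q y)"
      using ac H rT by (intro absolutely_continuous_fun_on_diff
          absolutely_continuous_fun_on_subinterval[of q T "\<lambda>s. X s q y" r T]) auto
    from absolutely_continuous_fun_on_derivative_bound[OF this negligible_Un[OF N(1) N'(1)] d0 order_refl H(3,4)]
    show ?thesis by simp
  qed
  show "X t 0 x = x + X t 0 0" if "0 \<le> t" "t \<le> T" "0 \<le> x" for t x
    using const[of 0 0 t x 0] that init[of 0] by simp
  show "X t s 0 = X t 0 0 - X s 0 0" if "0 \<le> s" "s \<le> t" "t \<le> T" for s t
    using const[of 0 s t 0 0] that init[of s 0] by simp
qed

text \<open>Turns each term of the Lagrangian formula into a measure on \<open>I\<close>: push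
  forward along the flow, then discard what lands outside \<open>I\<close>. Integrands vanishing off
  \<open>I\<close> do not see the discarded mass.\<close>

lemma restricted_pushforward:
  fixes h :: "'a \<Rightarrow> real"
  assumes M: "finite_measure M" and h: "h \<in> borel_measurable M" and I: "I \<in> sets borel"
  defines "Q \<equiv> restrict_space (distr M borel h) I"
  shows "finite_borel_measure_on I Q"
    and "\<And>f :: real \<Rightarrow> real. f \<in> borel_measurable borel \<Longrightarrow> (\<And>x. x \<notin> I \<Longrightarrow> f x = 0) \<Longrightarrow>
      (LINT x|Q. f x) = (LINT x|M. f (h x))"
    and "\<And>E. E \<in> sets (restrict_space borel I) \<Longrightarrow> measure Q E = (LINT x|M. indicator E (h x))"
proof -
  show fin: "finite_borel_measure_on I Q"
    unfolding finite_borel_measure_on_def Q_def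
    using I by (intro conjI finite_measure_restrict_space finite_measure.finite_measure_distr[OF M h])
      (auto simp: sets_restrict_space)
  show int: "(LINT x|Q. f x) = (LINT x|M. f (h x))"
    if f: "f \<in> borel_measurable borel" and 0: "\<And>x. x \<notin> I \<Longrightarrow> f x = 0" for f :: "real \<Rightarrow> real"
  proof -
    have ind: "(\<lambda>x. indicat_real I x *\<^sub>R f x) = f" using 0 by (force simp: indicator_def)
    have "(LINT x|Q. f x) = (LINT x|distr M borel h. f x)"
      unfolding Q_def using I by (subst integral_restrict_space) (simp_all only: ind, simp)
    also have "\<dots> = (LINT x|M. f (h x))" using h f by (rule integral_distr)
    finally show ?thesis .
  qed
  show "measure Q E = (LINT x|M. indicator E (h x))" if E: "E \<in> sets (restrict_space borel I)" for E
  proof -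
    have EI: "E \<subseteq> I" "E \<in> sets borel" using E I by (auto simp: sets_restrict_space_iff)
    have "E \<inter> space Q = E" using EI finite_borel_measure_onD(3)[OF fin] by auto
    then have "measure Q E = (LINT x|Q. indicator E x)" by simp
    also have "\<dots> = (LINT x|M. indicator E (h x))" using EI by (intro int) (auto simp: indicator_def)
    finally show ?thesis .
  qed
qed

lemma lagrangian_solution_transported:
  assumes \<alpha>: "velocity \<alpha>"
    and \<mu>: "finite_borel_measure_on {0<..T} \<mu>" and \<rho>0: "finite_borel_measure_on {0..<1} \<rho>0"
    and sol: "lagrangian_solution T \<alpha> \<rho>0 \<mu> \<rho>"
  shows "\<exists>A. admissible_displacement T A \<and> transported_by T A \<rho>0 \<mu> \<rho>"
proof -
  obtain X where X: "semiflow T (\<lambda>t x. \<alpha> (mass \<rho> t)) X"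
    and rep: "\<And>t E. t \<in> {0..T} \<Longrightarrow> E \<in> sets (restrict_space borel {0..<1}) \<Longrightarrow>
       measure (\<rho> t) E = (LINT x|\<rho>0. indicator E (X t 0 x)) + (LINT s:{0<..t}|\<mu>. indicator E (X t s 0))"
    using sol unfolding lagrangian_solution_def by blast
  have fin: "finite_borel_measure_on {0..<1} (\<rho> t)" if "t \<in> {0..T}" for t
    using sol that by (simp add: lagrangian_solution_def)
  have w: "\<bar>\<alpha> (mass \<rho> t)\<bar> \<le> 1" for t using velocity_mass_bounds[OF \<alpha>, of \<rho> t] by simp
  note flow = semiflow_space_homogeneous[OF X w]
  define A where "A t = X t 0 0" for t
  have A: "admissible_displacement T A"
    unfolding admissible_displacement_def
  proof (intro allI impI)
    fix s t assume st: "0 \<le> s" "s \<le> t" "t \<le> T"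
    \<comment> \<open>\<open>A t - A s\<close> is the position at time \<open>t\<close> of the
      particle entering at time \<open>s\<close>, and positions are nonnegative. The upper bound is
      the speed limit 1.\<close>
    have "0 \<le> X t s 0" using X st by (auto simp: semiflow_def)
    then show "0 \<le> A t - A s \<and> A t - A s \<le> t - s"
      using flow(1)[of 0 s t 0] flow(3)[of s t] st by (auto simp: A_def)
  qed
  have "(LINT x|\<rho> t. g x) = (LINT x|\<rho>0. g (x + A t)) + (LINT s:{0<..t}|\<mu>. g (A t - A s))"
    if t: "t \<in> {0..T}" and g: "g \<in> lipschitz_tests" for t g
  proof -
    \<comment> \<open>Restricting the measure instead of the integrand confines everything to
      \<open>s \<le> t\<close>, where the flow is constrained and equals
      \<open>A t - A s\<close>.\<close>
    define \<mu>t where "\<mu>t = restrict_space \<mu> {0<..t}"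
    obtain L where L: "L-lipschitz_on UNIV g" "\<forall>x. x \<notin> {0<..<1} \<longrightarrow> g x = 0"
      using g by (auto simp: lipschitz_tests_def)
    have gm: "g \<in> borel_measurable borel" and g0: "\<And>x. x \<notin> {0..<1} \<Longrightarrow> g x = 0"
      and gb: "\<And>x. \<bar>g x\<bar> \<le> L"
      using lipschitz_on_UNIV_realD(4)[OF L(1)] L(2) lipschitz_tests_bound[OF L] by auto
    have sub: "{0<..t} \<inter> space \<mu> = {0<..t}"
      using t by (auto simp: finite_borel_measure_onD(3)[OF \<mu>])
    have in_sets: "{0<..t} \<inter> space \<mu> \<in> sets \<mu>"
      unfolding sub finite_borel_measure_onD(2)[OF \<mu>] using t by (auto simp: sets_restrict_space_iff)
    have set_int: "(LINT s:{0<..t}|\<mu>. f s) = (LINT s|\<mu>t. f s)" for f :: "real \<Rightarrow> real"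
      unfolding \<mu>t_def set_lebesgue_integral_def by (rule integral_restrict_space[OF in_sets, symmetric])
    have sp: "space \<mu>t = {0<..t}" unfolding \<mu>t_def space_restrict_space by (rule sub)
    have "A \<in> borel_measurable \<mu>"
      using admissible_displacement_measurable[OF A, of "{0<..T}"]
      by (simp add: measurable_cong_sets[OF finite_borel_measure_onD(2)[OF \<mu>] refl] subset_eq)
    then have m1: "(\<lambda>s. A t - A s) \<in> borel_measurable \<mu>t"
      unfolding \<mu>t_def by (intro borel_measurable_diff measurable_restrict_space1) auto
    have f1: "finite_measure \<mu>t"
      unfolding \<mu>t_def using finite_borel_measure_onD(1)[OF \<mu>] in_sets[unfolded sub]
      by (rule finite_measure_restrict_space)
    have m0: "(\<lambda>x. x + A t) \<in> borel_measurable \<rho>0"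
      by (simp add: measurable_cong_sets[OF finite_borel_measure_onD(2)[OF \<rho>0] refl] measurable_restrict_space1)
    have I: "{0..<1::real} \<in> sets borel" by simp
    define P where "P = restrict_space (distr \<rho>0 borel (\<lambda>x. x + A t)) {0..<1}"
    define Q where "Q = restrict_space (distr \<mu>t borel (\<lambda>s. A t - A s)) {0..<1}"
    note p = restricted_pushforward[OF finite_borel_measure_onD(1)[OF \<rho>0] m0 I, folded P_def]
    note q = restricted_pushforward[OF f1 m1 I, folded Q_def]
    have decomp: "measure (\<rho> t) E = measure P E + measure Q E" if E: "E \<in> sets (restrict_space borel {0..<1})" for E
    proof -
      have x0: "X t 0 x = x + A t" if "x \<in> space \<rho>0" for x
        unfolding A_def using t that by (intro flow(2)) (auto simp: finite_borel_measure_onD(3)[OF \<rho>0])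
      have xs: "X t s 0 = A t - A s" if "s \<in> space \<mu>t" for s
        unfolding A_def using t that by (intro flow(3)) (auto simp: sp)
      have "(LINT x|\<rho>0. indicator E (X t 0 x)) = (LINT x|\<rho>0. indicat_real E (x + A t))"
        by (intro Bochner_Integration.integral_cong refl) (simp only: x0)
      moreover have "(LINT s|\<mu>t. indicator E (X t s 0)) = (LINT s|\<mu>t. indicat_real E (A t - A s))"
        by (intro Bochner_Integration.integral_cong refl) (simp only: xs)
      ultimately show ?thesis using rep[OF t E] p(3)[OF E] q(3)[OF E] by (simp add: set_int)
    qed
    have gr: "g \<in> borel_measurable (restrict_space borel {0..<1})" by (rule measurable_restrict_space1[OF gm])
    \<comment> \<open>The formula is an identity between values on sets. To pass to integrals, the
      same set function is decomposed both as \<open>\<rho> t\<close> minus \<open>P\<close> and as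
      \<open>Q\<close> minus the zero measure; the signed integral does not depend on the
      decomposition.\<close>
    let ?z = "null_measure Q"
    have z: "finite_borel_measure_on {0..<1} ?z"
      using finite_borel_measure_onD(2)[OF q(1)]
      by (auto simp: finite_borel_measure_on_def intro!: finite_measureI)
    have "(LINT x|\<rho> t. g x) - (LINT x|P. g x) = signed_integral {0..<1} (\<lambda>E. measure (\<rho> t) E - measure P E) g"
      using gb by (intro signed_integral_eq[OF fin[OF t] p(1) gr, symmetric]) auto
    also have "\<dots> = (LINT x|Q. g x) - (LINT x|?z. g x)"
      using gb decomp by (intro signed_integral_eq[OF q(1) z gr]) auto
    finally have "(LINT x|\<rho> t. g x) = (LINT x|P. g x) + (LINT x|Q. g x)" by simp
    then show ?thesis using p(2)[OF gm g0] q(2)[OF gm g0] by (simp add: set_int)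
  qed
  then show ?thesis using A unfolding transported_by_def by blast
qed

section \<open>Weak solutions\<close>

text \<open>The approximation is the forward average of \<open>g\<close> over an interval of length \<open>\<epsilon>\<close>,
  which preserves vanishing on \<open>[1, \<infinity>)\<close>.\<close>

lemma lipschitz_C1_approximation:
  fixes g :: "real \<Rightarrow> real"
  assumes g: "L-lipschitz_on UNIV g" and g0: "\<forall>x\<ge>1. g x = 0" and \<epsilon>: "\<epsilon> > 0"
  shows "\<exists>\<psi> \<psi>'. (\<forall>x. (\<psi> has_real_derivative \<psi>' x) (at x)) \<and> continuous_on UNIV \<psi>' \<and>
    L-lipschitz_on UNIV \<psi> \<and> (\<forall>x\<ge>1. \<psi> x = 0) \<and> (\<forall>x. \<bar>\<psi> x - g x\<bar> \<le> L * \<epsilon>)"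
proof -
  note gL = lipschitz_on_UNIV_realD[OF g]
  have "isCont g x" for x using gL(3)[of UNIV] by (simp add: continuous_on_eq_continuous_at)
  then obtain G where G: "\<And>x. (G has_real_derivative g x) (at x)"
    using einterval_antiderivative[of "-\<infinity>" "\<infinity>" g]
    by (auto simp: has_real_derivative_iff_has_vector_derivative)
  define \<psi> where "\<psi> x = (G (x + \<epsilon>) - G x) / \<epsilon>" for x
  define \<psi>' where "\<psi>' x = (g (x + \<epsilon>) - g x) / \<epsilon>" for x
  have "((\<lambda>x. G (x + \<epsilon>)) has_real_derivative g (x + \<epsilon>)) (at x)" for x
    using G[of "x + \<epsilon>"] by (simp add: DERIV_shift)
  then have der: "(\<psi> has_real_derivative \<psi>' x) (at x)" for x
    unfolding \<psi>_def \<psi>'_def by (intro DERIV_cdivide DERIV_diff G)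
  \<comment> \<open>The average of \<open>g\<close> is a value of \<open>g\<close> at a point to the
    right of \<open>x\<close> within distance \<open>\<epsilon>\<close>. Both the vanishing from 1
    on and the error bound follow from this.\<close>
  have mean: "\<exists>z. x < z \<and> z < x + \<epsilon> \<and> \<psi> x = g z" for x
    using MVT2[of x "x + \<epsilon>" G g] G \<epsilon> by (force simp: \<psi>_def)
  have bnd: "\<bar>\<psi>' x\<bar> \<le> L" for x
    using gL(1)[of "x + \<epsilon>" x] \<epsilon> by (simp add: \<psi>'_def field_simps)
  have "L-lipschitz_on UNIV \<psi>"
  proof (rule lipschitz_onI)
    show "dist (\<psi> x) (\<psi> y) \<le> L * dist x y" for x y
      using field_differentiable_bound[of UNIV \<psi> \<psi>' L x y] der bnd
      by (auto simp: dist_norm norm_minus_commute)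
  qed (rule gL(2))
  moreover have "\<psi> x = 0" if "x \<ge> 1" for x using mean[of x] g0 that by force
  moreover have "\<bar>\<psi> x - g x\<bar> \<le> L * \<epsilon>" for x
  proof -
    obtain z where z: "x < z" "z < x + \<epsilon>" "\<psi> x = g z" using mean[of x] by blast
    have "\<bar>g z - g x\<bar> \<le> L * \<bar>z - x\<bar>" by (rule gL(1))
    also have "\<dots> \<le> L * \<epsilon>" using z gL(2) by (intro mult_left_mono) auto
    finally show ?thesis by (simp add: z(3))
  qed
  moreover have "continuous_on UNIV \<psi>'"
    unfolding \<psi>'_def using \<epsilon> by (intro continuous_intros continuous_on_compose2[OF gL(3)[of UNIV]]) auto
  ultimately show ?thesis using der by blast
qed

text \<open>By completeness of Lebesgue measure no measurability of \<open>f\<close> has to be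
  assumed. This is what makes time integrals over \<open>\<rho> t\<close> accessible when the
  dependence on \<open>t\<close> is not known to be measurable.\<close>

lemma integrable_lebesgue_on_of_null:
  fixes f :: "real \<Rightarrow> real"
  assumes "negligible N" "\<And>t. t \<in> S - N \<Longrightarrow> f t = 0" "S \<in> sets lebesgue"
  shows "integrable (lebesgue_on S) f" "(LINT t|lebesgue_on S. f t) = 0"
proof -
  have ae: "AE t in lebesgue_on S. f t = 0"
    using assms by (subst AE_restrict_space_iff) (auto simp: eventually_ae_filter_negligible)
  have "f absolutely_integrable_on S"
  proof (rule absolutely_integrable_spike)
    show "(\<lambda>_. 0 :: real) absolutely_integrable_on S" by (simp add: absolutely_integrable_on_def)
  qed (use assms(1,2) in auto)
  then show "integrable (lebesgue_on S) f" using assms(3) by (rule absolutely_integrable_imp_integrable)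
  show "(LINT t|lebesgue_on S. f t) = 0" using ae by (rule integral_eq_zero_AE)
qed

section \<open>Representation of weak solutions by duality\<close>

locale weak_transport =
  fixes T :: real and \<alpha> :: "real \<Rightarrow> real" and \<rho>0 \<mu> :: "real measure" and \<rho> :: "real \<Rightarrow> real measure"
  assumes T: "T > 0" and \<alpha>: "velocity \<alpha>"
    and \<mu>: "finite_borel_measure_on {0<..T} \<mu>" and \<rho>0: "finite_borel_measure_on {0..<1} \<rho>0"
    and sol: "weak_solution T \<alpha> \<rho>0 \<mu> \<rho>"
begin

definition A :: "real \<Rightarrow> real" where "A t = integral {0..t} (\<lambda>s. \<alpha> (mass \<rho> s))"

lemma velocity_integrable: "(\<lambda>s. \<alpha> (mass \<rho> s)) integrable_on {0..T}"
proof (rule integrable_on_lebesgue_on)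
  have m: "mass \<rho> \<in> borel_measurable (lebesgue_on {0..T})"
    using sol unfolding weak_solution_def by blast
  \<comment> \<open>\<open>\<alpha>\<close> is known to be continuous only on \<open>{0..}\<close>,
    so the mass is regarded as a map into that half-line.\<close>
  have "mass \<rho> \<in> measurable (lebesgue_on {0..T}) (restrict_space borel {0..})"
    using m by (intro measurable_restrict_space2) (auto simp: mass_def)
  moreover have "\<alpha> \<in> borel_measurable (restrict_space borel {0..})"
    using \<alpha> by (auto simp: velocity_def intro: borel_measurable_continuous_on_restrict lipschitz_on_continuous_on)
  ultimately have "(\<lambda>s. \<alpha> (mass \<rho> s)) \<in> borel_measurable (lebesgue_on {0..T})"
    by (rule measurable_compose)
  moreover have "finite_measure (lebesgue_on {0..T})"
    using T by (intro finite_measureI) (simp add: emeasure_restrict_space)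
  moreover have "norm (\<alpha> (mass \<rho> s)) \<le> 1" for s
    using velocity_mass_bounds[OF \<alpha>, of \<rho> s] by simp
  ultimately show "integrable (lebesgue_on {0..T}) (\<lambda>s. \<alpha> (mass \<rho> s))"
    by (intro finite_measure.integrable_const_bound[where B = 1]) auto
qed simp

lemma A_admissible: "admissible_displacement T A"
  unfolding admissible_displacement_def
proof (intro allI impI)
  fix s t assume st: "0 \<le> s" "s \<le> t" "t \<le> T"
  have int: "(\<lambda>s. \<alpha> (mass \<rho> s)) integrable_on {u..v}" if "0 \<le> u" "v \<le> T" for u v
    using velocity_integrable by (rule integrable_subinterval_real) (use that in auto)
  have "A s + integral {s..t} (\<lambda>s. \<alpha> (mass \<rho> s)) = A t"
    unfolding A_def using st by (intro Henstock_Kurzweil_Integration.integral_combine int) auto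
  moreover have "0 \<le> integral {s..t} (\<lambda>s. \<alpha> (mass \<rho> s))"
    using st velocity_mass_bounds[OF \<alpha>] by (intro integral_nonneg int) (auto intro: less_imp_le)
  moreover have "integral {s..t} (\<lambda>s. \<alpha> (mass \<rho> s)) \<le> integral {s..t} (\<lambda>_. 1)"
    using st velocity_mass_bounds[OF \<alpha>] by (intro integral_le int) auto
  ultimately show "0 \<le> A t - A s \<and> A t - A s \<le> t - s" using st by simp
qed

lemma A_0 [simp]: "A 0 = 0"
  by (simp add: A_def)

text \<open>The test function \<open>\<psi> (x + A \<tau> - A t)\<close> solves the adjoint equation up to time \<open>\<tau>\<close>.  Its
  transport term vanishes, so it is admissible although \<open>t \<mapsto> \<rho> t\<close> is not known to be measurable.
  Freezing it after \<open>\<tau>\<close> keeps its value at \<open>x = 1\<close> equal to \<open>0\<close>.\<close>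

lemma C1_representation:
  fixes \<psi> \<psi>' :: "real \<Rightarrow> real"
  assumes der: "\<And>x. (\<psi> has_real_derivative \<psi>' x) (at x)" and cont: "continuous_on UNIV \<psi>'"
    and lip: "L-lipschitz_on UNIV \<psi>" and \<psi>0: "\<forall>x\<ge>1. \<psi> x = 0" and \<tau>: "\<tau> \<in> {0..T}"
  shows "(LINT x|\<rho> \<tau>. \<psi> x) = (LINT x|\<rho>0. \<psi> (x + A \<tau>)) + (LINT s:{0<..\<tau>}|\<mu>. \<psi> (A \<tau> - A s))"
proof -
  define \<phi> where "\<phi> t x = \<psi> (x + A \<tau> - A (min t \<tau>))" for t x
  have dx: "dx \<phi> t x = \<psi>' (x + A \<tau> - A (min t \<tau>))" if "x \<in> {0..1}" for t x
  proof -
    have "((\<lambda>y. \<phi> t y) has_real_derivative \<psi>' (x + A \<tau> - A (min t \<tau>)) * 1) (at x)"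
      unfolding \<phi>_def by (rule DERIV_chain2[OF der]) (auto intro!: derivative_eq_intros)
    then show ?thesis
      using that unfolding dx_def
      by (intro vector_derivative_at_within_ivl) (auto simp: has_real_derivative_iff_has_vector_derivative)
  qed
  have min_in: "min t \<tau> \<in> {0..T}" if "t \<in> {0..T}" for t using that \<tau> by auto
  have Amin: "continuous_on {0..T} (\<lambda>t. A (min t \<tau>))"
    by (rule continuous_on_compose2[OF admissible_displacement_continuous[OF A_admissible]])
      (use min_in in \<open>auto intro!: continuous_intros\<close>)
  have test: "\<phi> \<in> weak_test_functions T"
    unfolding weak_test_functions_def
  proof (intro CollectI conjI ballI)
    fix t assume t: "t \<in> {0..T}"
    have "0 \<le> A \<tau> - A (min t \<tau>)"
      using A_admissible \<tau> t by (auto simp: admissible_displacement_def)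
    then show "\<phi> t 1 = 0" using \<psi>0 by (simp add: \<phi>_def)
    show "\<phi> t differentiable_on {0..1}"
      unfolding differentiable_on_def
    proof
      fix x :: real
      have "((\<lambda>y. \<phi> t y) has_real_derivative \<psi>' (x + A \<tau> - A (min t \<tau>)) * 1) (at x within {0..1})"
        unfolding \<phi>_def by (rule DERIV_chain2[OF der]) (auto intro!: derivative_eq_intros)
      then show "\<phi> t differentiable at x within {0..1}"
        by (auto simp: has_field_derivative_def differentiable_def)
    qed
  next
    have "continuous_on ({0..T} \<times> {0..1::real}) (\<lambda>z. \<psi>' (snd z + A \<tau> - A (min (fst z) \<tau>)))"
      by (intro continuous_on_compose2[OF cont] continuous_intros continuous_on_compose2[OF Amin]) auto
    then show "continuous_on ({0..T} \<times> {0..1}) (\<lambda>(t, x). dx \<phi> t x)"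
      by (rule continuous_on_eq) (auto simp: dx)
  next
    fix x :: real
    have "L-lipschitz_on {0..T} (\<lambda>t. \<phi> t x)"
    proof (rule lipschitz_onI)
      fix s t assume st: "s \<in> {0..T}" "t \<in> {0..T}"
      have "\<bar>\<phi> s x - \<phi> t x\<bar> \<le> L * \<bar>A (min t \<tau>) - A (min s \<tau>)\<bar>"
        using lipschitz_on_UNIV_realD(1)[OF lip, of "x + A \<tau> - A (min s \<tau>)" "x + A \<tau> - A (min t \<tau>)"]
        by (simp add: \<phi>_def)
      also have "\<dots> \<le> L * \<bar>min t \<tau> - min s \<tau>\<bar>"
        using lipschitz_on_UNIV_realD(2)[OF lip]
        by (intro mult_left_mono admissible_displacement_abs[OF A_admissible] min_in st)
      also have "\<dots> \<le> L * \<bar>s - t\<bar>"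
        using lipschitz_on_UNIV_realD(2)[OF lip] by (intro mult_left_mono) auto
      finally show "dist (\<phi> s x) (\<phi> t x) \<le> L * dist s t" by (simp add: dist_real_def)
    qed (rule lipschitz_on_UNIV_realD(2)[OF lip])
    then show "\<exists>L. L-lipschitz_on {0..T} (\<lambda>t. \<phi> t x)" by blast
  qed
  obtain N where N: "negligible N"
    "\<And>t. t \<in> {0..T} - N \<Longrightarrow> (A has_real_derivative \<alpha> (mass \<rho> t)) (at t within {0..T})"
    using indefinite_integral_has_real_derivative_AE[OF velocity_integrable] unfolding A_def[symmetric] by blast
  have dt: "(\<lambda>s. \<phi> s x) differentiable (at t within {0..T})"
     "dt T \<phi> t x = - \<psi>' (x + A \<tau> - A t) * \<alpha> (mass \<rho> t)"
    if t: "0 < t" "t < \<tau>" "t \<notin> N" for t x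
  proof -
    have tT: "t \<in> {0..T}" using t \<tau> by auto
    have "((\<lambda>s. \<psi> (x + A \<tau> - A s)) has_real_derivative \<psi>' (x + A \<tau> - A t) * (0 - \<alpha> (mass \<rho> t))) (at t within {0..T})"
      using tT t by (intro DERIV_chain2[OF der] DERIV_diff DERIV_const N(2)) auto
    then have "((\<lambda>s. \<psi> (x + A \<tau> - A s)) has_vector_derivative - \<psi>' (x + A \<tau> - A t) * \<alpha> (mass \<rho> t)) (at t within {0..T})"
      by (simp add: has_real_derivative_iff_has_vector_derivative)
    then have v: "((\<lambda>s. \<phi> s x) has_vector_derivative - \<psi>' (x + A \<tau> - A t) * \<alpha> (mass \<rho> t)) (at t within {0..T})"
      by (rule has_vector_derivative_transform_within[where d = "\<tau> - t"])
        (use t tT in \<open>auto simp: \<phi>_def dist_real_def min_def\<close>)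
    then show "(\<lambda>s. \<phi> s x) differentiable (at t within {0..T})"
      by (rule differentiableI_vector)
    show "dt T \<phi> t x = - \<psi>' (x + A \<tau> - A t) * \<alpha> (mass \<rho> t)"
      unfolding dt_def using v T tT
      by (intro vector_derivative_within_cbox[where a = 0 and b = T, unfolded box_real]) auto
  qed
  \<comment> \<open>Freezing may destroy differentiability in time at \<open>\<tau>\<close> itself,
    so this point joins the exceptional set.\<close>
  define N' where "N' = insert \<tau> N"
  have N': "negligible N'" using N(1) by (simp add: N'_def)
  have good: "0 < t \<and> t < \<tau> \<and> t \<notin> N \<and> t \<in> {0..T} \<and> min t \<tau> = t" if "t \<in> {0<..\<tau>} - N'" for t
    using that \<tau> by (auto simp: N'_def)
  have sp: "space (\<rho> t) = {0..<1}" if "t \<in> {0..T}" for t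
    using sol that finite_borel_measure_onD(3) by (auto simp: weak_solution_def)
  have zero: "transport_term T \<alpha> \<rho> \<phi> t x = 0" if "t \<in> {0<..\<tau>} - N'" "x \<in> space (\<rho> t)" for t x
    using that good[OF that(1)] dt(2)[of t x] dx[of x t] sp[of t] by (auto simp: transport_term_def)
  have inner: "integrable (\<rho> t) (transport_term T \<alpha> \<rho> \<phi> t)"
     "(LINT x|\<rho> t. transport_term T \<alpha> \<rho> \<phi> t x) = 0" "(LINT x|\<rho> t. \<bar>transport_term T \<alpha> \<rho> \<phi> t x\<bar>) = 0"
    if "t \<in> {0<..\<tau>} - N'" for t
    using zero[OF that] by (simp_all cong: Bochner_Integration.integrable_cong Bochner_Integration.integral_cong)
  have St: "{0<..\<tau>} \<in> sets lebesgue" by simp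
  have "transport_integral_exists T \<alpha> \<rho> \<phi> \<tau>"
    unfolding transport_integral_exists_def
  proof (intro conjI)
    have "(AE x in \<rho> t. (\<lambda>s. \<phi> s x) differentiable (at t within {0..T})) \<and> integrable (\<rho> t) (transport_term T \<alpha> \<rho> \<phi> t)"
      if "t \<in> {0<..\<tau>} - N'" for t
      using dt(1)[of t] good[OF that] inner(1)[OF that] by auto
    then show "AE t in lebesgue_on {0<..\<tau>}. (AE x in \<rho> t. (\<lambda>s. \<phi> s x) differentiable (at t within {0..T})) \<and>
        integrable (\<rho> t) (transport_term T \<alpha> \<rho> \<phi> t)"
      using N' by (subst AE_restrict_space_iff) (auto simp: eventually_ae_filter_negligible)
    show "integrable (lebesgue_on {0<..\<tau>}) (\<lambda>t. LINT x|\<rho> t. \<bar>transport_term T \<alpha> \<rho> \<phi> t x\<bar>)"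
      by (rule integrable_lebesgue_on_of_null(1)[OF N' inner(3) St])
    show "integrable (lebesgue_on {0<..\<tau>}) (\<lambda>t. LINT x|\<rho> t. transport_term T \<alpha> \<rho> \<phi> t x)"
      by (rule integrable_lebesgue_on_of_null(1)[OF N' inner(2) St])
  qed
  then have "0 = (LINT t|lebesgue_on {0<..\<tau>}. LINT x|\<rho> t. transport_term T \<alpha> \<rho> \<phi> t x)
      + (LINT t:{0<..\<tau>}|\<mu>. \<phi> t 0) - (LINT x|\<rho> \<tau>. \<phi> \<tau> x) + (LINT x|\<rho>0. \<phi> 0 x)"
    using sol \<tau> test unfolding weak_solution_def by blast
  moreover have "(LINT t|lebesgue_on {0<..\<tau>}. LINT x|\<rho> t. transport_term T \<alpha> \<rho> \<phi> t x) = 0"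
    by (rule integrable_lebesgue_on_of_null(2)[OF N' inner(2) St])
  moreover have "(LINT t:{0<..\<tau>}|\<mu>. \<phi> t 0) = (LINT s:{0<..\<tau>}|\<mu>. \<psi> (A \<tau> - A s))"
    unfolding set_lebesgue_integral_def
    by (intro Bochner_Integration.integral_cong) (auto simp: \<phi>_def indicator_def min_def)
  \<comment> \<open>At time \<open>\<tau>\<close> the shift is 0 and at time 0 it is
    \<open>A \<tau>\<close>, since \<open>A 0 = 0\<close>.\<close>
  ultimately show ?thesis using \<tau> by (simp add: \<phi>_def min_def)
qed

text \<open>A Lipschitz \<open>g\<close> is replaced by a continuously differentiable
  \<open>\<psi>\<close> with uniform error \<open>L * \<epsilon>\<close>. Each of the three
  integrals changes by at most this error times a total mass, and letting \<open>\<epsilon>\<close>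
  tend to 0 transfers the identity from \<open>\<psi>\<close> to \<open>g\<close>.\<close>

lemma transported: "transported_by T A \<rho>0 \<mu> \<rho>"
  unfolding transported_by_def
proof (intro ballI)
  fix \<tau> g assume \<tau>: "\<tau> \<in> {0..T}" and "g \<in> lipschitz_tests"
  then obtain L where g: "L-lipschitz_on UNIV g" "\<forall>x. x \<notin> {0<..<1} \<longrightarrow> g x = 0"
    by (auto simp: lipschitz_tests_def)
  have L: "L \<ge> 0" by (rule lipschitz_on_UNIV_realD(2)[OF g(1)])
  have \<rho>\<tau>: "finite_borel_measure_on {0..<1} (\<rho> \<tau>)" using sol \<tau> by (auto simp: weak_solution_def)
  define K where "K = measure (\<rho> \<tau>) {0..<1} + measure \<rho>0 {0..<1} + measure \<mu> {0<..T}"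
  have K: "K \<ge> 0" by (simp add: K_def)
  define R where "R h = (LINT x|\<rho>0. h (x + A \<tau>)) + (LINT s:{0<..\<tau>}|\<mu>. h (A \<tau> - A s))" for h :: "real \<Rightarrow> real"
  have close: "\<bar>(LINT x|\<rho> \<tau>. g x) - R g\<bar> \<le> L * \<epsilon> * K" if \<epsilon>: "\<epsilon> > 0" for \<epsilon>
  proof -
    \<comment> \<open>Forward averaging can make \<open>\<psi>\<close> nonzero at 0 and slightly to
      its left. This is harmless, because the representation for \<open>\<psi>\<close> only asks for
      vanishing from 1 on and keeps the influx integral on \<open>{0<..\<tau>}\<close>.\<close>
    obtain \<psi> \<psi>' where \<psi>: "\<And>x. (\<psi> has_real_derivative \<psi>' x) (at x)" "continuous_on UNIV \<psi>'"
      "L-lipschitz_on UNIV \<psi>" "\<forall>x\<ge>1. \<psi> x = 0" "\<And>x. \<bar>\<psi> x - g x\<bar> \<le> L * \<epsilon>"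
      using lipschitz_C1_approximation[OF g(1) _ \<epsilon>] g(2) by auto
    have d: "\<bar>g x - \<psi> x\<bar> \<le> L * \<epsilon>" for x using \<psi>(5)[of x] by (simp add: abs_minus_commute)
    note gb = lipschitz_tests_bound[OF g]
    note gm = lipschitz_on_UNIV_realD(4)[OF g(1)] and \<psi>m = lipschitz_on_UNIV_realD(4)[OF \<psi>(3)]
    have "\<bar>(LINT x|\<rho> \<tau>. g x) - (LINT x|\<rho> \<tau>. \<psi> x)\<bar> \<le> L * \<epsilon> * measure (\<rho> \<tau>) {0..<1}"
      using d gb gm \<psi>m
      by (intro finite_borel_measure_on_integral_diff_bound[OF \<rho>\<tau>]) (auto intro: measurable_restrict_space1)
    moreover have "\<bar>(LINT x|\<rho>0. g (x + A \<tau>)) - (LINT x|\<rho>0. \<psi> (x + A \<tau>))\<bar> \<le> L * \<epsilon> * measure \<rho>0 {0..<1}"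
      using d gb
      by (intro finite_borel_measure_on_integral_diff_bound[OF \<rho>0])
        (auto intro!: measurable_compose[OF _ gm] measurable_compose[OF _ \<psi>m] measurable_restrict_space1)
    moreover have "\<bar>(LINT s:{0<..\<tau>}|\<mu>. g (A \<tau> - A s)) - (LINT s:{0<..\<tau>}|\<mu>. \<psi> (A \<tau> - A s))\<bar>
        \<le> L * \<epsilon> * measure \<mu> {0<..T}"
      unfolding set_lebesgue_integral_def
    proof (rule finite_borel_measure_on_integral_diff_bound[OF \<mu>])
      have Am: "(\<lambda>s. A \<tau> - A s) \<in> borel_measurable (restrict_space borel {0<..T})"
        by (intro borel_measurable_diff borel_measurable_const admissible_displacement_measurable[OF A_admissible]) auto
      have i: "indicat_real {0<..\<tau>} \<in> borel_measurable (restrict_space borel {0<..T})"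
        by (intro measurable_restrict_space1) simp
      show "(\<lambda>s. indicat_real {0<..\<tau>} s *\<^sub>R g (A \<tau> - A s)) \<in> borel_measurable (restrict_space borel {0<..T})"
        "(\<lambda>s. indicat_real {0<..\<tau>} s *\<^sub>R \<psi> (A \<tau> - A s)) \<in> borel_measurable (restrict_space borel {0<..T})"
        using i measurable_compose[OF Am gm] measurable_compose[OF Am \<psi>m]
        by (auto intro: borel_measurable_scaleR)
      show "\<bar>indicat_real {0<..\<tau>} s *\<^sub>R g (A \<tau> - A s)\<bar> \<le> L" for s
        using gb L by (auto simp: indicator_def)
      show "\<bar>indicat_real {0<..\<tau>} s *\<^sub>R g (A \<tau> - A s) - indicat_real {0<..\<tau>} s *\<^sub>R \<psi> (A \<tau> - A s)\<bar> \<le> L * \<epsilon>" for s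
        using d L \<epsilon> by (auto simp: indicator_def)
    qed
    moreover have "(LINT x|\<rho> \<tau>. \<psi> x) = R \<psi>"
      unfolding R_def by (rule C1_representation[OF \<psi>(1-4) \<tau>])
    ultimately show ?thesis unfolding R_def K_def by (simp add: distrib_left)
  qed
  have "\<bar>(LINT x|\<rho> \<tau>. g x) - R g\<bar> \<le> 0 + e" if e: "e > 0" for e
  proof -
    have LK: "L * K \<ge> 0" using L K by simp
    \<comment> \<open>The summand 1 in the denominator covers the case
      \<open>L * K = 0\<close>.\<close>
    have "\<bar>(LINT x|\<rho> \<tau>. g x) - R g\<bar> \<le> L * (e / (L * K + 1)) * K"
      using e LK by (intro close) simp
    also have "\<dots> = e * (L * K / (L * K + 1))" by simp
    also have "\<dots> \<le> e * 1" using e LK by (intro mult_left_mono) auto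
    finally show ?thesis by simp
  qed
  then have "\<bar>(LINT x|\<rho> \<tau>. g x) - R g\<bar> \<le> 0" by (rule field_le_epsilon)
  then show "(LINT x|\<rho> \<tau>. g x) = (LINT x|\<rho>0. g (x + A \<tau>)) + (LINT s:{0<..\<tau>}|\<mu>. g (A \<tau> - A s))"
    by (simp add: R_def)
qed

end

theorem theorem4p10:
  fixes T :: real and \<alpha> :: "real \<Rightarrow> real" and \<mu> \<rho>0 :: "real measure"
  assumes "T > 0"
    and "velocity \<alpha>"
    and "finite_borel_measure_on {0<..T} \<mu>" and "zero_singular_continuous_part {0<..T} \<mu>"
    and "finite_borel_measure_on {0..<1} \<rho>0" and "zero_singular_continuous_part {0..<1} \<rho>0"
  shows "(\<forall>\<rho>. lagrangian_solution T \<alpha> \<rho>0 \<mu> \<rho> \<longrightarrow> phi_continuous T \<rho>) \<and>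
         (\<forall>\<rho>. weak_solution T \<alpha> \<rho>0 \<mu> \<rho> \<longrightarrow> phi_continuous T \<rho>)"
proof (intro conjI allI impI)
  fix \<rho> assume sol: "lagrangian_solution T \<alpha> \<rho>0 \<mu> \<rho>"
  then have "\<forall>t\<in>{0..T}. finite_borel_measure_on {0..<1} (\<rho> t)"
    by (simp add: lagrangian_solution_def)
  then show "phi_continuous T \<rho>"
    using lagrangian_solution_transported[OF assms(2,3,5) sol]
      transported_by_phi_continuous[OF assms(5,3)] by blast
next
  fix \<rho> assume sol: "weak_solution T \<alpha> \<rho>0 \<mu> \<rho>"
  then have fin: "\<forall>t\<in>{0..T}. finite_borel_measure_on {0..<1} (\<rho> t)"
    by (simp add: weak_solution_def)
  interpret weak_transport T \<alpha> \<rho>0 \<mu> \<rho>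
    using assms sol by unfold_locales
  show "phi_continuous T \<rho>"
    by (rule transported_by_phi_continuous[OF assms(5,3) fin A_admissible transported])
qed

end
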